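(* Suppose that $\mu_{1},\mu_{2}\in\mathcal{P}_{\mathbb{R}}$ are nondegenerate measures such that $\mu_{2}$ is $\boxplus$-infinitely divisible, and let $\rho_{1}\in\mathcal{P}_{\mathbb{R}}$ satisfy $F_{\mu_{1}\boxplus\mu_{2}}=F_{\mu_{1}}\circ F_{\rho_{1}}$. Let $I\subset\mathbb{R}$ be an open interval with an endpoint $x_{0}$ such that $F_{\rho_{1}}(x)\in\mathbb{H}$ for every $x\in I$ and $F_{\rho_{1}}(x_{0})$ is real but not an atom of $\mu_{1}$. Denote by $p_{\mu_{1}\boxplus\mu_{2}}$ the density of $\mu_{1}\boxplus\mu_{2}$ relative to Lebesgue measure. Then $p_{\mu_{1}\boxplus\mu_{2}}(x)/|x-x_{0}|^{1/3}$ is bounded for $x\in I$ close to $x_{0}$.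
   Context: $\mathcal{P}_{\mathbb{R}}$ is the set of Borel probability measures on $\mathbb{R}$; nondegenerate means not a point mass; $\mathbb{H}$ is the open upper half-plane. For $\mu\in\mathcal{P}_{\mathbb{R}}$ put $G_{\mu}(z)=\int_{\mathbb{R}}\frac{d\mu(t)}{z-t}$ and $F_{\mu}(z)=1/G_{\mu}(z)$, $z\in\mathbb{H}$. The function $F_\mu$ has an inverse $F_{\mu}^{\langle-1\rangle}$ defined in an open set containing $\{iy:y>\beta\}$ for some $\beta>0$, and the free additive convolution $\mu=\mu_1\boxplus\mu_2$ is the unique probability measure with $z+F_{\mu}^{\langle-1\rangle}(z)=F_{\mu_{1}}^{\langle-1\rangle}(z)+F_{\mu_{2}}^{\langle-1\rangle}(z)$ on an open set containing $iy$ for all large $y$. A measure is $\boxplus$-infinitely divisible if, for every $n\in\mathbb{N}$, it is the $\boxplus$-convolution of $n$ copies of some probability measure. The measure $\rho_1$ exists, is unique, and (since $\mu_2$ is $\boxplus$-infinitely divisible) is itself $\boxplus$-infinitely divisible. Consequently $F_{\rho_1}$ extends to a homeomorphism of $\overline{\mathbb{H}}$ onto $\overline{F_{\rho_1}(\mathbb{H})}$; $F_{\rho_1}(x)$ for $x\in\mathbb{R}$ denotes the value of this extension. The density on $I$ is $p_{\mu_1\boxplus\mu_2}(x)=-\frac1\pi\Im G_{\mu_1}(F_{\rho_1}(x))$. *)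

theory Defs
  imports "HOL-Probability.Probability" "HOL-Complex_Analysis.Complex_Analysis"
begin

text \<open>Borel probability measures on the real line are measures satisfying the library
  predicate \<^const>\<open>real_distribution\<close>.\<close>

definition upper_half_plane :: "complex set" where
  "upper_half_plane = {z. 0 < Im z}"

definition nondegenerate :: "real measure \<Rightarrow> bool" where
  "nondegenerate \<mu> \<longleftrightarrow> (\<forall>a. \<mu> \<noteq> return borel a)"

definition cauchy_transform :: "real measure \<Rightarrow> complex \<Rightarrow> complex" where
  "cauchy_transform \<mu> z = (LINT t|\<mu>. 1 / (z - complex_of_real t))"

definition F_transform :: "real measure \<Rightarrow> complex \<Rightarrow> complex" where
  "F_transform \<mu> z = 1 / cauchy_transform \<mu> z"

text \<open>\<open>\<phi>\<close> is the inverse of the F-transform on the open set \<open>U\<close>, which contains \<open>\<i>y\<close> for all large \<open>y\<close>.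
  An F-transform need not be injective on the upper half-plane: \<open>z - 1/z\<close> (the symmetric Bernoulli
  measure) has two right inverses there, defined near \<open>\<i>y\<close> for all \<open>y > 2\<close>. The inverse meant is
  the branch at infinity, which inverts the F-transform on truncated nontangential cones; the
  limit condition selects it.\<close>

definition F_inverse_on :: "real measure \<Rightarrow> complex set \<Rightarrow> (complex \<Rightarrow> complex) \<Rightarrow> bool" where
  "F_inverse_on \<mu> U \<phi> \<longleftrightarrow>
     open U \<and> (\<exists>\<beta>>0. \<forall>y>\<beta>. \<i> * complex_of_real y \<in> U) \<and>
     \<phi> holomorphic_on U \<and>
     (\<forall>z\<in>U. \<phi> z \<in> upper_half_plane \<and> F_transform \<mu> (\<phi> z) = z) \<and>
     ((\<lambda>y. \<phi> (\<i> * complex_of_real y) / (\<i> * complex_of_real y)) \<longlongrightarrow> 1) at_top"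

text \<open>\<open>\<mu>\<close> is the free additive convolution of \<open>\<mu>1\<close> and \<open>\<mu>2\<close>. Since \<open>\<mu>\<close> is unique, the operation is
  rendered as a relation. Restricting the three inverses to a common open set \<open>U\<close> is harmless, as
  the intersection of their domains again contains \<open>\<i>y\<close> for all large \<open>y\<close>.\<close>

definition is_free_convolution :: "real measure \<Rightarrow> real measure \<Rightarrow> real measure \<Rightarrow> bool" where
  "is_free_convolution \<mu>1 \<mu>2 \<mu> \<longleftrightarrow>
     real_distribution \<mu>1 \<and> real_distribution \<mu>2 \<and> real_distribution \<mu> \<and>
     (\<exists>U \<phi> \<phi>1 \<phi>2. F_inverse_on \<mu> U \<phi> \<and> F_inverse_on \<mu>1 U \<phi>1 \<and> F_inverse_on \<mu>2 U \<phi>2 \<and>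
        (\<forall>z\<in>U. z + \<phi> z = \<phi>1 z + \<phi>2 z))"

text \<open>\<open>free_convolution_power \<nu> n \<mu>\<close>: \<open>\<mu>\<close> is the free convolution of \<open>n \<ge> 1\<close> copies of \<open>\<nu>\<close>.\<close>

inductive free_convolution_power :: "real measure \<Rightarrow> nat \<Rightarrow> real measure \<Rightarrow> bool"
  for \<nu> :: "real measure" where
  one: "real_distribution \<nu> \<Longrightarrow> free_convolution_power \<nu> 1 \<nu>"
| Suc: "free_convolution_power \<nu> n \<kappa> \<Longrightarrow> is_free_convolution \<kappa> \<nu> \<mu> \<Longrightarrow>
        free_convolution_power \<nu> (Suc n) \<mu>"

definition freely_infinitely_divisible :: "real measure \<Rightarrow> bool" where
  "freely_infinitely_divisible \<mu> \<longleftrightarrow> (\<forall>n\<ge>1. \<exists>\<nu>. free_convolution_power \<nu> n \<mu>)"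

text \<open>The value at a real point of the continuous extension of the F-transform to the closed
  upper half-plane; only meaningful when that extension exists.\<close>

definition F_boundary :: "real measure \<Rightarrow> real \<Rightarrow> complex" where
  "F_boundary \<rho> x = Lim (at (complex_of_real x) within upper_half_plane) (F_transform \<rho>)"

definition lebesgue_density_on :: "real measure \<Rightarrow> real set \<Rightarrow> (real \<Rightarrow> real) \<Rightarrow> bool" where
  "lebesgue_density_on \<mu> I p \<longleftrightarrow>
     set_borel_measurable borel I p \<and> (\<forall>x\<in>I. 0 \<le> p x) \<and>
     (\<forall>A\<in>sets borel. A \<subseteq> I \<longrightarrow> emeasure \<mu> A = (\<integral>\<^sup>+x\<in>A. ennreal (p x) \<partial>lborel))"

end

theory Submission
  imports Defs "HOL-Real_Asymp.Real_Asymp"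
begin

text \<open>Since \<open>\<mu>2\<close> is infinitely divisible, its inverse F-transform is \<open>z - N2 z\<close> for a holomorphic self-map
  \<open>N2\<close> of the (closed) half-plane, so \<open>\<omega> = F\<^bsub>\<rho>1\<^esub>\<close> is inverted by \<open>w - N w\<close> with \<open>N = N2 \<circ> F\<^bsub>\<mu>1\<^esub>\<close>; in particular
  \<open>Im (N w) \<le> Im w\<close> on the range of \<open>\<omega>\<close>. For such \<open>w, w'\<close>, the Herglotz representation of \<open>N\<close> yields
  \<open>Re (1 - (N w - N w') / (w - w')) \<ge> c \<bar>w - w'\<bar>\<^sup>2\<close> locally, with \<open>c > 0\<close> because \<open>\<mu>2\<close> is nondegenerate. Hence
  \<open>\<bar>\<omega> z - \<omega> z'\<bar>\<^sup>3 \<le> K \<bar>z - z'\<bar>\<close>: \<open>\<omega>\<close> extends to the real line, and \<open>Im (\<omega> x) = O(\<bar>x - x0\<bar> powr (1/3))\<close>.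

  It remains to bound \<open>E w = - Im (G w) / Im w\<close>, where \<open>G = G\<^bsub>\<mu>1\<^esub>\<close>. Harnack's inequality for \<open>N2\<close> and
  \<open>Im (N w) \<le> Im w\<close> give \<open>E w \<le> (1 + \<bar>G w\<bar>)\<^sup>2 / k\<close>, which makes \<open>1 / (1 + \<bar>G\<bar>)\<close> Lipschitz on
  \<open>{w. Im (N w) \<le> Im w}\<close>. This set contains \<open>u + iy\<close> for \<open>u = \<omega> x0\<close> and \<open>y > 0\<close>, so if \<open>G\<close> were unbounded
  near \<open>u\<close>, then \<open>y (1 + \<bar>G (u + iy)\<bar>) \<ge> k\<close>, and \<open>u\<close> would be an atom of \<open>\<mu>1\<close>.\<close>

section \<open>Cauchy transforms and F-transforms\<close>

lemma upper_half_plane_iff [simp]: "z \<in> upper_half_plane \<longleftrightarrow> 0 < Im z"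
  by (simp add: upper_half_plane_def)

lemma open_upper_half_plane: "open upper_half_plane"
  by (simp add: upper_half_plane_def open_halfspace_Im_gt)

lemma convex_upper_half_plane: "convex upper_half_plane"
  by (simp add: upper_half_plane_def convex_halfspace_Im_gt)

lemma connected_upper_half_plane: "connected upper_half_plane"
  by (simp add: convex_upper_half_plane convex_connected)

text \<open>The squared L2 norm of the Cauchy kernel. It is the ratio of
  \<open>- Im (cauchy_transform \<mu> z)\<close> to \<open>Im z\<close>, so bounding it reduces the
  density estimate to an estimate of \<open>Im z\<close>.\<close>

definition cauchy_energy :: "real measure \<Rightarrow> complex \<Rightarrow> real" where
  "cauchy_energy \<mu> z = (LINT t|\<mu>. 1 / (cmod (z - of_real t))\<^sup>2)"

lemma Im_le_cmod_diff_real: "Im z \<le> cmod (z - of_real t)"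
  using abs_Im_le_cmod[of "z - of_real t"] by simp

lemma inverse_cmod_diff_real_le:
  assumes "0 < Im z"
  shows "1 / cmod (z - of_real t) \<le> 1 / Im z"
  using assms Im_le_cmod_diff_real[of z t] by (intro divide_left_mono) (auto intro!: mult_pos_pos)

context real_distribution
begin

lemma integrable_cauchy_kernel:
  assumes "0 < Im z"
  shows "integrable M (\<lambda>t. 1 / (z - complex_of_real t))"
  using inverse_cmod_diff_real_le[OF assms]
  by (intro integrable_const_bound[of _ "1 / Im z"]) (auto simp: norm_divide intro!: AE_I2)

lemma integrable_cauchy_kernel_product:
  assumes "0 < Im z" "0 < Im w"
  shows "integrable M (\<lambda>t. 1 / ((z - complex_of_real t) * (w - complex_of_real t)))"
proof (intro integrable_const_bound[of _ "1 / Im z * (1 / Im w)"] AE_I2)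
  fix t
  have "1 / cmod (z - of_real t) * (1 / cmod (w - of_real t)) \<le> 1 / Im z * (1 / Im w)"
    using assms by (intro mult_mono inverse_cmod_diff_real_le) auto
  then show "cmod (1 / ((z - of_real t) * (w - of_real t))) \<le> 1 / Im z * (1 / Im w)"
    by (simp add: norm_divide norm_mult)
qed auto

lemma integrable_cauchy_energy:
  assumes "0 < Im z"
  shows "integrable M (\<lambda>t. 1 / (cmod (z - of_real t))\<^sup>2)"
  using integrable_norm[OF integrable_cauchy_kernel_product[OF assms assms]]
  by (simp add: norm_divide norm_mult power2_eq_square)

lemma Im_cauchy_transform:
  assumes "0 < Im z"
  shows "Im (cauchy_transform M z) = - Im z * cauchy_energy M z"
proof -
  have "Im (1 / (z - of_real t)) = - Im z * (1 / (cmod (z - of_real t))\<^sup>2)" for t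
    by (simp add: Im_divide cmod_power2)
  then have "Im (cauchy_transform M z) = (LINT t|M. - Im z * (1 / (cmod (z - of_real t))\<^sup>2))"
    unfolding cauchy_transform_def
    using integral_Im[OF integrable_cauchy_kernel[OF assms]] by simp
  then show ?thesis
    by (simp only: integral_mult_right_zero cauchy_energy_def)
qed

lemma cauchy_energy_pos:
  assumes "0 < Im z"
  shows "0 < cauchy_energy M z"
proof -
  have "cauchy_energy M z \<ge> 0"
    unfolding cauchy_energy_def by (intro integral_nonneg_AE) auto
  moreover have "cauchy_energy M z \<noteq> 0"
  proof
    assume "cauchy_energy M z = 0"
    then have "AE t in M. 1 / (cmod (z - of_real t))\<^sup>2 = 0"
      unfolding cauchy_energy_def
      using integral_nonneg_eq_0_iff_AE[OF integrable_cauchy_energy[OF assms]] by simp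
    moreover have "z \<noteq> of_real t" for t
      using assms by auto
    ultimately show False by simp
  qed
  ultimately show ?thesis by simp
qed

lemma Im_cauchy_transform_neg: "0 < Im z \<Longrightarrow> Im (cauchy_transform M z) < 0"
  by (simp add: Im_cauchy_transform cauchy_energy_pos)

lemma cauchy_transform_nonzero: "0 < Im z \<Longrightarrow> cauchy_transform M z \<noteq> 0"
  using Im_cauchy_transform_neg by fastforce

lemma cauchy_transform_diff:
  assumes "0 < Im z" "0 < Im w"
  shows "cauchy_transform M z - cauchy_transform M w =
    (w - z) * (LINT t|M. 1 / ((z - complex_of_real t) * (w - complex_of_real t)))"
proof -
  have nz: "z \<noteq> of_real t" "w \<noteq> of_real t" for t
    using assms by auto
  have "cauchy_transform M z - cauchy_transform M w =
      (LINT t|M. 1 / (z - complex_of_real t) - 1 / (w - complex_of_real t))"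
    unfolding cauchy_transform_def
    by (simp add: integrable_cauchy_kernel assms)
  also have "\<dots> = (LINT t|M. (w - z) * (1 / ((z - complex_of_real t) * (w - complex_of_real t))))"
    by (intro Bochner_Integration.integral_cong refl) (use nz in \<open>simp add: field_simps\<close>)
  finally show ?thesis by (simp only: integral_mult_right_zero)
qed

text \<open>The Cauchy-Schwarz inequality for the product kernel of
  \<open>cauchy_transform_diff\<close>, stated with upper bounds for the two energies, which is the
  form in which they become available.\<close>

lemma cauchy_transform_diff_le:
  assumes "0 < Im z" "0 < Im w" "0 < a" "0 < b"
    and "cauchy_energy M z \<le> a\<^sup>2" "cauchy_energy M w \<le> b\<^sup>2"
  shows "cmod (cauchy_transform M z - cauchy_transform M w) \<le> cmod (z - w) * (a * b)"
proof -
  \<comment> \<open>A weighted arithmetic-geometric mean inequality; with weights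
    \<open>b / a\<close> and \<open>a / b\<close> each term integrates to at most
    \<open>a * b\<close>.\<close>
  have *: "1 / (cmod (z - of_real t) * cmod (w - of_real t)) \<le>
      (b / a * (1 / (cmod (z - of_real t))\<^sup>2) + a / b * (1 / (cmod (w - of_real t))\<^sup>2)) / 2" for t
  proof -
    define x y where "x = 1 / cmod (z - of_real t)" and "y = 1 / cmod (w - of_real t)"
    have "0 \<le> (b * x - a * y)\<^sup>2 / (a * b)"
      using assms by simp
    also have "\<dots> = b / a * x\<^sup>2 + a / b * y\<^sup>2 - 2 * (x * y)"
      using assms by (simp add: field_simps power2_eq_square)
    finally show ?thesis
      by (simp add: x_def y_def power_divide)
  qed
  have "cmod (LINT t|M. 1 / ((z - complex_of_real t) * (w - complex_of_real t)))
      \<le> (LINT t|M. cmod (1 / ((z - complex_of_real t) * (w - complex_of_real t))))"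
    by (rule integral_norm_bound)
  also have "\<dots> \<le> (LINT t|M. (b / a * (1 / (cmod (z - of_real t))\<^sup>2)
      + a / b * (1 / (cmod (w - of_real t))\<^sup>2)) / 2)"
    using * assms(1,2)
    by (intro integral_mono integrable_norm integrable_cauchy_kernel_product integrable_divide
          Bochner_Integration.integrable_add integrable_mult_right integrable_cauchy_energy)
      (simp_all add: norm_divide norm_mult)
  also have "\<dots> = (b / a * cauchy_energy M z + a / b * cauchy_energy M w) / 2"
    using assms(1,2) unfolding cauchy_energy_def
    by (simp add: integrable_cauchy_energy del: times_divide_eq_right)
  also have "\<dots> \<le> (b / a * a\<^sup>2 + a / b * b\<^sup>2) / 2"
    using assms by (intro divide_right_mono add_mono mult_left_mono) auto
  also have "\<dots> = a * b"
    using assms by (simp add: power2_eq_square)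
  finally show ?thesis
    by (simp add: cauchy_transform_diff assms norm_mult norm_minus_commute mult_left_mono)
qed

text \<open>The variance of \<open>1 / cmod (z - of_real t)\<close> under \<open>M\<close> is
  nonnegative.\<close>

lemma norm_cauchy_transform_square_le:
  assumes "0 < Im z"
  shows "(cmod (cauchy_transform M z))\<^sup>2 \<le> cauchy_energy M z"
proof -
  define f where "f t = 1 / cmod (z - of_real t)" for t
  have int: "integrable M f" "integrable M (\<lambda>t. (f t)\<^sup>2)"
    using integrable_norm[OF integrable_cauchy_kernel[OF assms]] integrable_cauchy_energy[OF assms]
    by (simp_all add: f_def[abs_def] norm_divide power_divide)
  have "cmod (cauchy_transform M z) \<le> expectation f"
    using integral_norm_bound[of M "\<lambda>t. 1 / (z - complex_of_real t)"]
    by (simp add: cauchy_transform_def f_def[abs_def] norm_divide)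
  then have "(cmod (cauchy_transform M z))\<^sup>2 \<le> (expectation f)\<^sup>2"
    by (intro power_mono) auto
  also have "\<dots> \<le> expectation (\<lambda>t. (f t)\<^sup>2)"
    using variance_eq[OF int] variance_positive[of f] by simp
  finally show ?thesis
    by (simp add: cauchy_energy_def f_def[abs_def] power_divide)
qed

text \<open>By \<open>cauchy_transform_diff\<close> the difference quotient at \<open>w\<close> is
  minus an integral whose kernel is bounded for \<open>z\<close> near \<open>w\<close>, so dominated
  convergence yields the derivative.\<close>

lemma holomorphic_cauchy_transform: "cauchy_transform M holomorphic_on upper_half_plane"
proof -
  have "(cauchy_transform M has_field_derivative
      - (LINT t|M. 1 / ((w - complex_of_real t) * (w - complex_of_real t)))) (at w)" if w: "0 < Im w" for w
  proof -
    define K where "K z = (LINT t|M. 1 / ((z - complex_of_real t) * (w - complex_of_real t)))" for z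
    have lim: "(K \<longlongrightarrow> K w) (at w)"
      unfolding tendsto_at_iff_sequentially o_def
    proof (intro allI impI)
      fix X :: "nat \<Rightarrow> complex"
      assume X: "X \<longlonglongrightarrow> w"
      have "(\<lambda>n. Im (X n)) \<longlonglongrightarrow> Im w" using X by (rule tendsto_Im)
      then have ev: "\<forall>\<^sub>F n in sequentially. Im (X n) > Im w / 2"
        using w by (intro order_tendstoD(1)) auto
      then obtain N where N: "\<And>n. n \<ge> N \<Longrightarrow> Im (X n) > Im w / 2"
        by (auto simp: eventually_sequentially)
      have nz: "w \<noteq> of_real t" for t using w by auto
      have "(\<lambda>n. K (X (n + N))) \<longlonglongrightarrow> K w"
        unfolding K_def
      proof (rule integral_dominated_convergence[where w = "\<lambda>_. 2 / Im w * (1 / Im w)"])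
        show "AE t in M. (\<lambda>n. 1 / ((X (n + N) - of_real t) * (w - of_real t))) \<longlonglongrightarrow>
            1 / ((w - of_real t) * (w - of_real t))"
          using nz LIMSEQ_ignore_initial_segment[OF X, of N]
          by (intro AE_I2 tendsto_intros) auto
        show "AE t in M. cmod (1 / ((X (n + N) - of_real t) * (w - of_real t))) \<le> 2 / Im w * (1 / Im w)" for n
        proof (rule AE_I2)
          fix t
          have I: "Im (X (n + N)) > Im w / 2" using N by simp
          have "1 / cmod (X (n + N) - of_real t) \<le> 1 / Im (X (n + N))"
            using I w by (intro inverse_cmod_diff_real_le) auto
          also have "\<dots> \<le> 2 / Im w"
            using I w by (simp add: field_simps)
          finally have "1 / cmod (X (n + N) - of_real t) * (1 / cmod (w - of_real t)) \<le> 2 / Im w * (1 / Im w)"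
            using w by (intro mult_mono inverse_cmod_diff_real_le) auto
          then show "cmod (1 / ((X (n + N) - of_real t) * (w - of_real t))) \<le> 2 / Im w * (1 / Im w)"
            by (simp add: norm_divide norm_mult)
        qed
      qed auto
      then show "(\<lambda>n. K (X n)) \<longlonglongrightarrow> K w"
        by (rule LIMSEQ_offset)
    qed
    have "\<forall>\<^sub>F z in at w. 0 < Im z"
      using eventually_at_in_open'[OF open_upper_half_plane, of w] w by simp
    then have "\<forall>\<^sub>F z in at w. - K z = (cauchy_transform M z - cauchy_transform M w) / (z - w)"
      using eventually_neq_at_within[of w w UNIV]
    proof eventually_elim
      case (elim z)
      then show ?case
        by (simp add: cauchy_transform_diff w K_def divide_simps) (simp add: algebra_simps)
    qed
    then show ?thesis
      unfolding has_field_derivative_iff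
      using Lim_transform_eventually[OF tendsto_minus[OF lim]] by (simp add: K_def)
  qed
  then show ?thesis
    unfolding holomorphic_on_open[OF open_upper_half_plane] by (metis upper_half_plane_iff)
qed

text \<open>Since \<open>F = 1 / G\<close>, its imaginary part is \<open>Im z\<close> times the
  energy divided by the square of \<open>cmod G\<close>, and that quotient is at least 1 by the
  variance inequality.\<close>

lemma Im_F_transform_ge:
  assumes "0 < Im z"
  shows "Im z \<le> Im (F_transform M z)"
proof -
  have pos: "0 < (cmod (cauchy_transform M z))\<^sup>2"
    using cauchy_transform_nonzero[OF assms] by simp
  have "Im z * (cmod (cauchy_transform M z))\<^sup>2 \<le> Im z * cauchy_energy M z"
    using assms by (intro mult_left_mono norm_cauchy_transform_square_le) auto
  moreover have "Im (F_transform M z) = Im z * cauchy_energy M z / (cmod (cauchy_transform M z))\<^sup>2"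
    by (simp add: F_transform_def Im_divide cmod_power2 Im_cauchy_transform[OF assms])
  ultimately show ?thesis
    using pos by (simp only: pos_le_divide_eq)
qed

lemma Im_F_transform_pos: "0 < Im z \<Longrightarrow> 0 < Im (F_transform M z)"
  using Im_F_transform_ge[of z] by simp

lemma holomorphic_F_transform: "F_transform M holomorphic_on upper_half_plane"
  unfolding F_transform_def[abs_def] using cauchy_transform_nonzero
  by (intro holomorphic_intros holomorphic_cauchy_transform) auto

section \<open>Nontangential behaviour at infinity\<close>

text \<open>Inside the cone, \<open>cmod (X n - of_real t)\<close> is at least
  \<open>Im (X n)\<close>, hence at least \<open>cmod (X n) / C\<close>, uniformly in
  \<open>t\<close>. This supplies the dominating constant for the limits of integrals below.\<close>

lemma nontangential_kernel:
  assumes "\<forall>\<^sub>F n in sequentially. 0 < Im (X n) \<and> cmod (X n) \<le> C * Im (X n)"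
    and "filterlim X at_infinity sequentially"
  shows "(\<lambda>n. X n / (X n - of_real t)) \<longlonglongrightarrow> 1"
    and "\<forall>\<^sub>F n in sequentially. \<forall>t. cmod (X n / (X n - of_real t)) \<le> C"
proof -
  have "(\<lambda>n. 1 / (1 - of_real t / X n)) \<longlonglongrightarrow> 1 / (1 - 0)"
    by (intro tendsto_intros tendsto_divide_0[OF tendsto_const] assms(2)) auto
  moreover have "\<forall>\<^sub>F n in sequentially. 1 / (1 - of_real t / X n) = X n / (X n - of_real t)"
    using assms(1)
  proof eventually_elim
    case (elim n)
    then have "X n \<noteq> 0" "X n \<noteq> of_real t" by auto
    then show ?case by (simp add: divide_simps)
  qed
  ultimately show "(\<lambda>n. X n / (X n - of_real t)) \<longlonglongrightarrow> 1"
    using Lim_transform_eventually by force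
  show "\<forall>\<^sub>F n in sequentially. \<forall>t. cmod (X n / (X n - of_real t)) \<le> C"
    using assms(1)
  proof eventually_elim
    case (elim n)
    show ?case
    proof
      fix t
      have "0 < Im (X n)" "Im (X n) \<le> cmod (X n - of_real t)"
        using elim Im_le_cmod_diff_real by auto
      moreover have "0 \<le> C"
        using elim by (smt (verit) norm_ge_zero zero_le_mult_iff)
      ultimately have "cmod (X n) \<le> C * cmod (X n - of_real t)"
        using elim by (smt (verit) mult_left_mono)
      with \<open>0 < Im (X n)\<close> \<open>Im (X n) \<le> cmod (X n - of_real t)\<close>
      show "cmod (X n / (X n - of_real t)) \<le> C"
        using \<open>0 \<le> C\<close> by (simp add: norm_divide divide_simps)
    qed
  qed
qed

text \<open>The product kernel is the one occurring in \<open>cauchy_transform_diff\<close>; its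
  limit shows that the transform separates points far up in a cone.\<close>

lemma integral_nontangential_kernel_product:
  assumes X: "\<forall>\<^sub>F n in sequentially. 0 < Im (X n) \<and> cmod (X n) \<le> C * Im (X n)"
      "filterlim X at_infinity sequentially"
    and Y: "\<forall>\<^sub>F n in sequentially. 0 < Im (Y n) \<and> cmod (Y n) \<le> C * Im (Y n)"
      "filterlim Y at_infinity sequentially"
  shows "(\<lambda>n. LINT t|M. X n / (X n - complex_of_real t) * (Y n / (Y n - complex_of_real t))) \<longlonglongrightarrow> 1"
proof -
  obtain N where N: "\<And>n t. n \<ge> N \<Longrightarrow> cmod (X n / (X n - of_real t)) \<le> C"
      "\<And>n t. n \<ge> N \<Longrightarrow> cmod (Y n / (Y n - of_real t)) \<le> C"
    using eventually_conj[OF nontangential_kernel(2)[OF X] nontangential_kernel(2)[OF Y]]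
    by (auto simp: eventually_sequentially)
  have "(\<lambda>n. LINT t|M. X (n + N) / (X (n + N) - complex_of_real t) *
      (Y (n + N) / (Y (n + N) - complex_of_real t))) \<longlonglongrightarrow> (LINT t|M. 1 * 1)"
  proof (rule integral_dominated_convergence[where w = "\<lambda>_. C * C"])
    show "AE t in M. (\<lambda>n. X (n + N) / (X (n + N) - complex_of_real t) *
      (Y (n + N) / (Y (n + N) - complex_of_real t))) \<longlonglongrightarrow> 1 * 1"
      by (intro AE_I2 tendsto_mult LIMSEQ_ignore_initial_segment[OF nontangential_kernel(1)[OF X]]
          LIMSEQ_ignore_initial_segment[OF nontangential_kernel(1)[OF Y]])
    show "AE t in M. cmod (X (n + N) / (X (n + N) - complex_of_real t) *
      (Y (n + N) / (Y (n + N) - complex_of_real t))) \<le> C * C" for n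
    proof (rule AE_I2)
      fix t
      show "cmod (X (n + N) / (X (n + N) - complex_of_real t) *
        (Y (n + N) / (Y (n + N) - complex_of_real t))) \<le> C * C"
        using N[of "n + N" t] norm_ge_zero[of "X (n + N) / (X (n + N) - complex_of_real t)"]
        unfolding norm_mult by (intro mult_mono norm_ge_zero) linarith+
    qed
  qed auto
  then show ?thesis
    using prob_space by (auto dest: LIMSEQ_offset)
qed

lemma cauchy_transform_nontangential:
  assumes X: "\<forall>\<^sub>F n in sequentially. 0 < Im (X n) \<and> cmod (X n) \<le> C * Im (X n)"
      "filterlim X at_infinity sequentially"
  shows "(\<lambda>n. X n * cauchy_transform M (X n)) \<longlonglongrightarrow> 1"
proof -
  obtain N where N: "\<And>n t. n \<ge> N \<Longrightarrow> cmod (X n / (X n - of_real t)) \<le> C"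
    using nontangential_kernel(2)[OF X] by (auto simp: eventually_sequentially)
  have "(\<lambda>n. LINT t|M. X (n + N) / (X (n + N) - complex_of_real t)) \<longlonglongrightarrow> (LINT t|M. 1)"
  proof (rule integral_dominated_convergence[where w = "\<lambda>_. C"])
    show "AE t in M. (\<lambda>n. X (n + N) / (X (n + N) - complex_of_real t)) \<longlonglongrightarrow> 1"
      by (intro AE_I2 LIMSEQ_ignore_initial_segment[OF nontangential_kernel(1)[OF X]])
    show "AE t in M. cmod (X (n + N) / (X (n + N) - complex_of_real t)) \<le> C" for n
      by (intro AE_I2 N) auto
  qed auto
  moreover have "(LINT t|M. X n / (X n - complex_of_real t)) = X n * cauchy_transform M (X n)" for n
    unfolding cauchy_transform_def by (simp flip: integral_mult_right_zero)
  ultimately show ?thesis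
    using prob_space by (auto dest: LIMSEQ_offset)
qed

text \<open>Two distinct points with the same value would make the integral of the product kernel
  vanish, while after multiplication by both points that integral tends to 1. The radius grows with
  \<open>y\<close> so that the ball captures every branch asymptotic to
  \<open>\<i> * of_real y\<close>.\<close>

lemma inj_on_F_transform_near_infinity:
  "\<forall>\<^sub>F y in at_top. inj_on (F_transform M) (ball (\<i> * of_real y) (y / 2))"
proof (rule ccontr)
  assume "\<not> ?thesis"
  then have "\<exists>y>real n. \<not> inj_on (F_transform M) (ball (\<i> * of_real y) (y / 2))" for n
    unfolding eventually_at_top_dense by blast
  then have "\<exists>y v w. y > real n \<and> v \<in> ball (\<i> * of_real y) (y / 2) \<and> w \<in> ball (\<i> * of_real y) (y / 2) \<and>
      v \<noteq> w \<and> F_transform M v = F_transform M w" for n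
    unfolding inj_on_def by blast
  then obtain y V W where y: "\<And>n. y n > real n"
    and VW: "\<And>n. V n \<in> ball (\<i> * of_real (y n)) (y n / 2)" "\<And>n. W n \<in> ball (\<i> * of_real (y n)) (y n / 2)"
      "\<And>n. V n \<noteq> W n" "\<And>n. F_transform M (V n) = F_transform M (W n)"
    by metis
  have y0: "y n > 0" for n using y[of n] by linarith
  \<comment> \<open>Points of the ball have imaginary part above \<open>y n / 2\<close> and modulus
    below \<open>3 * y n / 2\<close>, which explains the aperture 3.\<close>
  have cone: "y n / 2 < Im X \<and> cmod X \<le> 3 * Im X" if "X \<in> ball (\<i> * of_real (y n)) (y n / 2)" for X n
  proof -
    have d: "cmod (\<i> * of_real (y n) - X) < y n / 2"
      using that by (simp add: dist_norm)
    have "y n - Im X \<le> cmod (\<i> * of_real (y n) - X)"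
      using abs_Im_le_cmod[of "\<i> * of_real (y n) - X"] by simp
    moreover have "cmod X \<le> y n + cmod (\<i> * of_real (y n) - X)"
      using norm_triangle_ineq4[of "\<i> * of_real (y n)" "\<i> * of_real (y n) - X"] y0[of n]
      by (simp add: norm_mult)
    ultimately show ?thesis using d by linarith
  qed
  have inf: "filterlim X at_infinity sequentially"
    if "\<And>n. X n \<in> ball (\<i> * of_real (y n)) (y n / 2)" for X :: "nat \<Rightarrow> complex"
  proof -
    have "filterlim (\<lambda>n. real n / 2) at_top sequentially"
      by real_asymp
    moreover have "\<forall>\<^sub>F n in sequentially. real n / 2 \<le> cmod (X n)"
    proof (intro always_eventually allI)
      fix n
      show "real n / 2 \<le> cmod (X n)"
        using cone[OF that[of n]] y[of n] abs_Im_le_cmod[of "X n"] by linarith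
    qed
    ultimately show ?thesis
      unfolding filterlim_at_infinity_conv_norm_at_top by (rule filterlim_at_top_mono)
  qed
  have ev: "\<forall>\<^sub>F n in sequentially. 0 < Im (X n) \<and> cmod (X n) \<le> 3 * Im (X n)"
    if "\<And>n. X n \<in> ball (\<i> * of_real (y n)) (y n / 2)" for X :: "nat \<Rightarrow> complex"
  proof (intro always_eventually allI)
    fix n
    show "0 < Im (X n) \<and> cmod (X n) \<le> 3 * Im (X n)"
      using cone[OF that[of n]] y0[of n] by linarith
  qed
  have "(LINT t|M. V n / (V n - complex_of_real t) * (W n / (W n - complex_of_real t))) = 0" for n
  proof -
    have pos: "0 < Im (V n)" "0 < Im (W n)"
      using cone[OF VW(1)[of n]] cone[OF VW(2)[of n]] y0[of n] by linarith+
    have "(W n - V n) * (LINT t|M. 1 / ((V n - complex_of_real t) * (W n - complex_of_real t))) = 0"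
      using VW(4)[of n] cauchy_transform_diff[OF pos] cauchy_transform_nonzero pos
      by (simp add: F_transform_def)
    then have "(LINT t|M. 1 / ((V n - complex_of_real t) * (W n - complex_of_real t))) = 0"
      using VW(3)[of n] by simp
    moreover have "(LINT t|M. V n / (V n - complex_of_real t) * (W n / (W n - complex_of_real t))) =
        (LINT t|M. V n * W n * (1 / ((V n - complex_of_real t) * (W n - complex_of_real t))))"
      by (intro Bochner_Integration.integral_cong) auto
    ultimately show ?thesis
      by (simp only: integral_mult_right_zero) simp
  qed
  then show False
    using integral_nontangential_kernel_product[OF ev inf ev inf, OF VW(1) VW(1) VW(2) VW(2)]
    by (simp add: LIMSEQ_const_iff)
qed

text \<open>With \<open>G\<close> the Cauchy transform, the quotient equals
  \<open>X y / (\<i> * of_real y)\<close> divided by \<open>X y * G (X y)\<close>. The latter tends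
  to 1 because the hypothesis keeps \<open>X y\<close> in a cone.\<close>

lemma F_transform_asymptotics:
  fixes X :: "real \<Rightarrow> complex"
  assumes "((\<lambda>y. X y / (\<i> * of_real y)) \<longlongrightarrow> 1) at_top"
  shows "((\<lambda>y. F_transform M (X y) / (\<i> * of_real y)) \<longlongrightarrow> 1) at_top"
proof (rule tendsto_at_topI_sequentially)
  fix y :: "nat \<Rightarrow> real"
  assume y: "filterlim y at_top sequentially"
  define Z where "Z n = X (y n)" for n
  have Z: "(\<lambda>n. Z n / (\<i> * of_real (y n))) \<longlonglongrightarrow> 1"
    using filterlim_compose[OF assms y] by (simp add: Z_def)
  have ypos: "\<forall>\<^sub>F n in sequentially. 0 < y n"
    using y by (simp add: filterlim_at_top_dense)
  have "\<forall>\<^sub>F n in sequentially. dist (Z n / (\<i> * of_real (y n))) 1 < 1 / 2"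
    using tendstoD[OF Z, of "1/2"] by simp
  then have ev: "\<forall>\<^sub>F n in sequentially. y n / 2 \<le> Im (Z n) \<and> cmod (Z n) \<le> 3 * Im (Z n) \<and> 0 < Im (Z n)"
    using ypos
  proof eventually_elim
    case (elim n)
    have "Z n - \<i> * of_real (y n) = (Z n / (\<i> * of_real (y n)) - 1) * (\<i> * of_real (y n))"
      using elim by (simp add: field_simps)
    then have d: "cmod (Z n - \<i> * of_real (y n)) \<le> y n / 2"
      using elim by (simp add: norm_mult dist_norm)
    have "y n - Im (Z n) \<le> cmod (Z n - \<i> * of_real (y n))"
      using abs_Im_le_cmod[of "Z n - \<i> * of_real (y n)"] by simp
    moreover have "cmod (Z n) \<le> y n + cmod (Z n - \<i> * of_real (y n))"
      using norm_triangle_ineq[of "\<i> * of_real (y n)" "Z n - \<i> * of_real (y n)"] elim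
      by (simp add: norm_mult)
    ultimately show ?case using d elim by (intro conjI) linarith+
  qed
  have "filterlim (\<lambda>n. y n / 2) at_top sequentially"
    using filterlim_tendsto_pos_mult_at_top[OF tendsto_const _ y, of "1/2"] by simp
  moreover have "\<forall>\<^sub>F n in sequentially. y n / 2 \<le> cmod (Z n)"
    using ev
  proof eventually_elim
    case (elim n)
    then show ?case using abs_Im_le_cmod[of "Z n"] by linarith
  qed
  ultimately have inf: "filterlim Z at_infinity sequentially"
    unfolding filterlim_at_infinity_conv_norm_at_top by (rule filterlim_at_top_mono)
  have "(\<lambda>n. Z n * cauchy_transform M (Z n)) \<longlonglongrightarrow> 1"
    by (rule cauchy_transform_nontangential[where C = 3, OF _ inf])
      (use ev in \<open>eventually_elim, auto\<close>)
  then have "(\<lambda>n. Z n / (\<i> * of_real (y n)) / (Z n * cauchy_transform M (Z n))) \<longlonglongrightarrow> 1 / 1"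
    using Z by (intro tendsto_divide) auto
  moreover have "\<forall>\<^sub>F n in sequentially. Z n / (\<i> * of_real (y n)) / (Z n * cauchy_transform M (Z n))
      = F_transform M (X (y n)) / (\<i> * of_real (y n))"
    using ev
  proof eventually_elim
    case (elim n)
    then have "Z n \<noteq> 0" by auto
    then show ?case by (simp add: F_transform_def Z_def[symmetric])
  qed
  ultimately show "(\<lambda>n. F_transform M (X (y n)) / (\<i> * of_real (y n))) \<longlonglongrightarrow> 1"
    using Lim_transform_eventually by force
qed

section \<open>Atoms and point masses\<close>

text \<open>The scaled kernel is bounded by 1 and tends to 0 for every \<open>t\<close> other than
  \<open>u\<close>, so only an atom at \<open>u\<close> could contribute in the limit.\<close>

lemma cauchy_transform_no_atom:
  assumes "measure M {u} = 0"
  shows "(\<lambda>n. of_real (1 / real (Suc n)) * cauchy_transform M (Complex u (1 / real (Suc n)))) \<longlonglongrightarrow> 0"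
proof -
  define y where "y n = 1 / real (Suc n)" for n
  have y: "y n > 0" "y \<longlonglongrightarrow> 0" for n
    using LIMSEQ_inverse_real_of_nat by (auto simp: y_def[abs_def] inverse_eq_divide)
  have "emeasure M {u} = 0"
    using assms by (simp add: emeasure_eq_measure)
  then have "AE t in M. t \<noteq> u"
    by (intro AE_I[of _ _ "{u}"]) auto
  then have lim: "AE t in M. (\<lambda>n. of_real (y n) / (Complex u (y n) - of_real t)) \<longlonglongrightarrow> 0"
  proof eventually_elim
    case (elim t)
    have "(\<lambda>n. of_real (y n) / (Complex u (y n) - of_real t)) \<longlonglongrightarrow> of_real 0 / (Complex u 0 - of_real t)"
      by (intro tendsto_intros y tendsto_Complex) (use elim in \<open>auto simp: complex_eq_iff\<close>)
    then show ?case by simp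
  qed
  have "(\<lambda>n. LINT t|M. of_real (y n) / (Complex u (y n) - of_real t)) \<longlonglongrightarrow> (LINT t|M. (0::complex))"
  proof (rule integral_dominated_convergence[where w = "\<lambda>_. 1"])
    show "AE t in M. cmod (of_real (y n) / (Complex u (y n) - of_real t)) \<le> 1" for n
    proof (rule AE_I2)
      fix t
      show "cmod (of_real (y n) / (Complex u (y n) - of_real t)) \<le> 1"
        using y(1)[of n] Im_le_cmod_diff_real[of "Complex u (y n)" t]
        by (simp add: norm_divide divide_simps)
    qed
  qed (use lim in auto)
  moreover have "(LINT t|M. of_real (y n) / (Complex u (y n) - of_real t)) =
      of_real (y n) * cauchy_transform M (Complex u (y n))" for n
    unfolding cauchy_transform_def by (simp flip: integral_mult_right_zero)
  ultimately show ?thesis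
    by (simp add: y_def)
qed

text \<open>The given value makes the energy at \<open>Complex a y\<close> equal to its largest
  possible value \<open>1 / y\<^sup>2\<close>. The integrand reaches this value only at
  \<open>t = a\<close>, so almost every \<open>t\<close> equals \<open>a\<close>.\<close>

lemma eq_return_if_cauchy_transform:
  assumes "0 < y" "cauchy_transform M (Complex a y) = 1 / (\<i> * of_real y)"
  shows "M = return borel a"
proof -
  have pos: "0 < Im (Complex a y)" using assms by simp
  have "- y * cauchy_energy M (Complex a y) = - (1 / y)"
    using Im_cauchy_transform[OF pos] assms(1) unfolding assms(2) by (simp add: Im_divide power2_eq_square)
  then have "cauchy_energy M (Complex a y) = 1 / y\<^sup>2"
    using assms(1) by (simp add: field_simps power2_eq_square)
  then have "(LINT t|M. 1 / y\<^sup>2 - 1 / (cmod (Complex a y - of_real t))\<^sup>2) = 0"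
    using prob_space integrable_cauchy_energy[OF pos]
    by (simp add: cauchy_energy_def)
  moreover have nn: "0 \<le> 1 / y\<^sup>2 - 1 / (cmod (Complex a y - of_real t))\<^sup>2" for t
  proof -
    have "(1 / cmod (Complex a y - of_real t))\<^sup>2 \<le> (1 / Im (Complex a y))\<^sup>2"
      using inverse_cmod_diff_real_le[OF pos] by (intro power_mono) auto
    then show ?thesis by (simp add: power_divide)
  qed
  ultimately have "AE t in M. 1 / y\<^sup>2 - 1 / (cmod (Complex a y - of_real t))\<^sup>2 = 0"
    using integrable_cauchy_energy[OF pos]
    by (subst (asm) integral_nonneg_eq_0_iff_AE) auto
  then have ae: "AE t in M. t = a"
  proof eventually_elim
    case (elim t)
    have "(cmod (Complex a y - of_real t))\<^sup>2 = (a - t)\<^sup>2 + y\<^sup>2"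
      by (simp add: cmod_power2)
    with elim assms(1) have "y\<^sup>2 = (a - t)\<^sup>2 + y\<^sup>2"
      by (metis eq_iff_diff_eq_0 div_by_1 divide_divide_eq_right mult_1)
    then show ?case by simp
  qed
  show ?thesis
  proof (rule measure_eqI)
    fix A assume A: "A \<in> sets M"
    have "emeasure M A = emeasure M (if a \<in> A then space M else {})"
      using A ae by (intro emeasure_eq_AE) (auto elim!: eventually_mono)
    then show "emeasure M A = emeasure (return borel a) A"
      using A emeasure_space_1 by (simp add: indicator_def)
  qed simp
qed

end

section \<open>Herglotz representation on the half-plane\<close>

lemma holomorphic_circle_mean:
  assumes "f holomorphic_on cball 0 1" "cmod \<zeta> < 1"
  shows "((\<lambda>t. f (cis (2 * pi * t)) * (cis (2 * pi * t) / (cis (2 * pi * t) - \<zeta>))) has_integral f \<zeta>) {0..1}"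
proof -
  have "((\<lambda>u. f u / (u - \<zeta>)) has_contour_integral (2 * of_real pi * \<i> * f \<zeta>)) (circlepath 0 1)"
    using assms by (intro Cauchy_integral_circlepath_simple) auto
  then have "((\<lambda>t. f (cis (2 * pi * t)) / (cis (2 * pi * t) - \<zeta>) * (2 * pi * \<i> * cis (2 * pi * t)))
      has_integral (2 * of_real pi * \<i> * f \<zeta>)) {0..1}"
    unfolding has_contour_integral vector_derivative_circlepath
    by (simp add: circlepath cis_conv_exp mult_ac)
  from has_integral_mult_right[OF this, of "1 / (2 * of_real pi * \<i>)"]
  show ?thesis by (simp add: mult_ac)
qed

text \<open>Adding the Cauchy formula for \<open>f\<close> and its analogue for the conjugate of
  \<open>f\<close> produces the real part of \<open>f\<close> under the integral; a multiple of the
  case of the origin turns the Cauchy kernel into the Herglotz kernel.\<close>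

lemma herglotz_circle:
  assumes f: "f holomorphic_on cball 0 1" and \<zeta>: "cmod \<zeta> < 1"
  shows "((\<lambda>t. of_real (Re (f (cis (2 * pi * t)))) * ((cis (2 * pi * t) + \<zeta>) / (cis (2 * pi * t) - \<zeta>)))
    has_integral f \<zeta> - \<i> * of_real (Im (f 0))) {0..1}"
proof -
  define e where "e t = cis (2 * pi * t)" for t
  have e: "cmod (e t) = 1" "e t \<noteq> 0" "cnj (e t) = 1 / e t" for t
    by (simp_all add: e_def cis_cnj divide_inverse)
  have ne: "e t \<noteq> \<zeta>" for t using e(1)[of t] \<zeta> by auto
  have mean: "((\<lambda>t. f (e t) * (e t / (e t - \<xi>)) + cnj (f (e t)) * (e t / (e t - \<xi>))) has_integral
      f \<xi> + cnj (f 0)) {0..1}" if \<xi>: "cmod \<xi> < 1" for \<xi>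
  proof (rule has_integral_add)
    show "((\<lambda>t. f (e t) * (e t / (e t - \<xi>))) has_integral f \<xi>) {0..1}"
      unfolding e_def by (rule holomorphic_circle_mean[OF f \<xi>])
    have nz: "1 - cnj \<xi> * z \<noteq> 0" if "cmod z \<le> 1" for z
    proof
      assume "1 - cnj \<xi> * z = 0"
      then have "cmod \<xi> * cmod z = 1"
        by (metis eq_iff_diff_eq_0 complex_mod_cnj norm_mult norm_one)
      moreover have "cmod \<xi> * cmod z \<le> cmod \<xi> * 1"
        using that by (intro mult_left_mono) auto
      ultimately show False using \<xi> by simp
    qed
    \<comment> \<open>On the circle the conjugate of \<open>e t\<close> is its inverse, so
      conjugating this holomorphic function gives \<open>cnj (f (e t))\<close> times the Cauchy
      kernel. Its mean is its value at 0.\<close>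
    have "((\<lambda>z. f z / (1 - cnj \<xi> * z)) holomorphic_on cball 0 1)"
      using nz by (intro holomorphic_intros f) auto
    from holomorphic_circle_mean[OF this, of 0]
    have "((\<lambda>t. f (e t) / (1 - cnj \<xi> * e t)) has_integral f 0) {0..1}"
      using e(2) by (simp add: e_def)
    then have "((\<lambda>t. cnj (f (e t) / (1 - cnj \<xi> * e t))) has_integral cnj (f 0)) {0..1}"
      by (simp only: has_integral_cnj[unfolded o_def])
    moreover have "cnj (f (e t) / (1 - cnj \<xi> * e t)) = cnj (f (e t)) * (e t / (e t - \<xi>))" for t
    proof -
      have "e t \<noteq> \<xi>" using e(1)[of t] \<xi> by auto
      then show ?thesis using e(2)[of t] by (simp add: e(3) field_simps)
    qed
    ultimately show "((\<lambda>t. cnj (f (e t)) * (e t / (e t - \<xi>))) has_integral cnj (f 0)) {0..1}"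
      by simp
  qed
  \<comment> \<open>The Herglotz kernel is twice the Cauchy kernel
    \<open>e t / (e t - \<zeta>)\<close> minus 1, and at the origin the Cauchy kernel is 1.\<close>
  have "((\<lambda>t. (f (e t) * (e t / (e t - \<zeta>)) + cnj (f (e t)) * (e t / (e t - \<zeta>))) -
      1 / 2 * (f (e t) * (e t / (e t - 0)) + cnj (f (e t)) * (e t / (e t - 0)))) has_integral
      (f \<zeta> + cnj (f 0)) - 1 / 2 * (f 0 + cnj (f 0))) {0..1}"
    using \<zeta> by (intro has_integral_diff has_integral_mult_right mean) auto
  moreover have "(f (e t) * (e t / (e t - \<zeta>)) + cnj (f (e t)) * (e t / (e t - \<zeta>))) -
      1 / 2 * (f (e t) * (e t / (e t - 0)) + cnj (f (e t)) * (e t / (e t - 0))) =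
      of_real (Re (f (e t))) * ((e t + \<zeta>) / (e t - \<zeta>))" for t
  proof -
    have "(e t + \<zeta>) / (e t - \<zeta>) = 2 * (e t / (e t - \<zeta>)) - 1"
      using ne[of t] by (simp add: field_simps)
    moreover have "of_real (Re (f (e t))) = (f (e t) + cnj (f (e t))) / 2"
      by (simp add: complex_add_cnj)
    moreover have "(a * q + b * q) - 1 / 2 * (a * 1 + b * 1) = (a + b) / 2 * (2 * q - 1)" for a b q :: complex
      by (simp add: field_simps)
    ultimately show ?thesis by (simp only: diff_zero divide_self[OF e(2)])
  qed
  moreover have "(f \<zeta> + cnj (f 0)) - 1 / 2 * (f 0 + cnj (f 0)) = f \<zeta> - \<i> * of_real (Im (f 0))"
    by (simp add: complex_eq_iff)
  ultimately show ?thesis by (simp only: e_def)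
qed

text \<open>The rotations about \<open>\<i>\<close>, i.e. the half-plane form of the kernels \<open>(\<xi> + \<zeta>) / (\<xi> - \<zeta>)\<close>
  with \<open>\<xi> = (C + \<i> S)\<^sup>2\<close>.\<close>

definition half_plane_rotation :: "real \<Rightarrow> real \<Rightarrow> complex \<Rightarrow> complex" where
  "half_plane_rotation C S w = (C * w - S) / (S * w + C)"

lemma half_plane_rotation_denom_nonzero:
  fixes C S :: real and w :: complex
  assumes "C\<^sup>2 + S\<^sup>2 = 1" "0 < Im w"
  shows "S * w + C \<noteq> 0"
  using assms by (auto simp: complex_eq_iff)

text \<open>The Herglotz formula carried to the half-plane by the Cayley transform \<open>c\<close>
  with inverse \<open>h\<close>. The functions \<open>A n\<close> stand in for \<open>N\<close> and
  have densities \<open>g n\<close>, so no representing measure on the boundary has to be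
  constructed.\<close>

lemma nevanlinna_approximation:
  assumes N: "N holomorphic_on upper_half_plane" and Im: "\<And>z. 0 < Im z \<Longrightarrow> 0 \<le> Im (N z)"
  obtains g :: "nat \<Rightarrow> real \<Rightarrow> real" and A :: "nat \<Rightarrow> complex \<Rightarrow> complex"
  where "\<And>n t. 0 \<le> g n t"
    and "\<And>n w. 0 < Im w \<Longrightarrow> ((\<lambda>t. of_real (g n t) * half_plane_rotation (cos (pi * t)) (sin (pi * t)) w)
      has_integral A n w - Re (N \<i>)) {0..1}"
    and "\<And>w. 0 < Im w \<Longrightarrow> (\<lambda>n. A n w) \<longlonglongrightarrow> N w"
proof -
  define h where "h \<zeta> = \<i> * (1 + \<zeta>) / (1 - \<zeta>)" for \<zeta> :: complex
  define f where "f \<zeta> = - \<i> * N (h \<zeta>)" for \<zeta>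
  define c where "c w = (w - \<i>) / (w + \<i>)" for w :: complex
  \<comment> \<open>Radii below 1 make the dilation of \<open>f\<close> holomorphic on the closed
    disc; their limit 1 recovers \<open>N\<close>.\<close>
  define r where "r n = 1 - 1 / (real n + 2)" for n
  have r: "0 \<le> r n" "r n < 1" for n
    by (auto simp: r_def field_simps)
  have r_lim: "r \<longlonglongrightarrow> 1"
    unfolding r_def by real_asymp
  have h: "0 < Im (h \<zeta>)" if "cmod \<zeta> < 1" for \<zeta>
  proof -
    have "(cmod \<zeta>)\<^sup>2 < 1" using that by (simp add: abs_square_less_1)
    moreover have "\<zeta> \<noteq> 1" using that by auto
    then have "0 < (1 - Re \<zeta>)\<^sup>2 + (Im \<zeta>)\<^sup>2"
      by (auto simp: complex_eq_iff sum_power2_gt_zero_iff)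
    moreover have "Im (h \<zeta>) = (1 - (cmod \<zeta>)\<^sup>2) / ((1 - Re \<zeta>)\<^sup>2 + (Im \<zeta>)\<^sup>2)"
      unfolding h_def cmod_power2 by (simp add: Im_divide) (simp add: algebra_simps power2_eq_square)
    ultimately show ?thesis by simp
  qed
  have f: "f holomorphic_on ball 0 1"
    unfolding f_def h_def[abs_def]
    by (intro holomorphic_intros holomorphic_on_compose_gen[OF _ N, unfolded o_def])
      (use h in \<open>auto simp: h_def\<close>)
  have c: "cmod (c w) < 1" "h (c w) = w" if "0 < Im w" for w
  proof -
    have nz: "w + \<i> \<noteq> 0" using that by (auto simp: complex_eq_iff)
    have "(cmod (w - \<i>))\<^sup>2 < (cmod (w + \<i>))\<^sup>2"
      using that unfolding cmod_power2 by (simp add: power2_eq_square algebra_simps)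
    then show "cmod (c w) < 1"
      using nz by (simp add: c_def norm_divide divide_simps power_less_imp_less_base)
    show "h (c w) = w"
      using nz by (simp add: h_def c_def divide_simps)
  qed
  have fr: "(\<lambda>\<zeta>. f (r n * \<zeta>)) holomorphic_on cball 0 1" for n
  proof (intro holomorphic_on_compose_gen[OF _ f, unfolded o_def] holomorphic_intros)
    have "r n * cmod \<zeta> < 1" if "cmod \<zeta> \<le> 1" for \<zeta> :: complex
      using r[of n] that mult_left_mono[of "cmod \<zeta>" 1 "r n"] by simp
    then show "(\<lambda>\<zeta>. complex_of_real (r n) * \<zeta>) ` cball 0 1 \<subseteq> ball 0 1"
      using r[of n] by (auto simp: norm_mult dist_norm)
  qed
  show ?thesis
  proof
    show "0 \<le> Re (f (r n * cis (2 * pi * t)))" for n t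
      using Im h r[of n] by (simp add: f_def norm_mult)
  next
    fix n w assume w: "0 < Im (w :: complex)"
    have "((\<lambda>t. \<i> * (of_real (Re (f (r n * cis (2 * pi * t)))) *
          ((cis (2 * pi * t) + c w) / (cis (2 * pi * t) - c w)))) has_integral
        \<i> * (f (r n * c w) - \<i> * of_real (Im (f (of_real (r n) * 0))))) {0..1}"
      by (intro has_integral_mult_right herglotz_circle[OF fr] c w)
    moreover have "\<i> * (of_real (Re (f (r n * cis (2 * pi * t)))) *
          ((cis (2 * pi * t) + c w) / (cis (2 * pi * t) - c w))) =
        of_real (Re (f (r n * cis (2 * pi * t)))) * half_plane_rotation (cos (pi * t)) (sin (pi * t)) w" for t
    proof -
      define \<xi> where "\<xi> = cis (pi * t)"
      have \<xi>: "cis (2 * pi * t) = \<xi> * \<xi>" "\<xi> \<noteq> 0"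
        by (simp_all add: \<xi>_def cis_mult mult.assoc)
      have nz: "w + \<i> \<noteq> 0" using w by (auto simp: complex_eq_iff)
      \<comment> \<open>The half angle makes \<open>\<xi> * \<xi>\<close> the point on the circle;
        multiplying numerator and denominator of the rotation by \<open>\<xi>\<close> leaves only
        \<open>\<xi> * \<xi>\<close>.\<close>
      have CS: "\<xi> * complex_of_real (cos (pi * t)) = (\<xi> * \<xi> + 1) / 2"
        "\<xi> * complex_of_real (sin (pi * t)) = (\<xi> * \<xi> - 1) / (2 * \<i>)"
      proof -
        have "complex_of_real (cos (pi * t)) = (\<xi> + cnj \<xi>) / 2"
          "complex_of_real (sin (pi * t)) = (\<xi> - cnj \<xi>) / (2 * \<i>)"
          by (simp_all add: \<xi>_def complex_eq_iff)
        moreover have "\<xi> * cnj \<xi> = 1"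
          by (simp add: \<xi>_def complex_norm_square[symmetric])
        ultimately show "\<xi> * complex_of_real (cos (pi * t)) = (\<xi> * \<xi> + 1) / 2"
          "\<xi> * complex_of_real (sin (pi * t)) = (\<xi> * \<xi> - 1) / (2 * \<i>)"
          by (simp_all add: algebra_simps)
      qed
      have "half_plane_rotation (cos (pi * t)) (sin (pi * t)) w =
          (\<xi> * cos (pi * t) * w - \<xi> * sin (pi * t)) / (\<xi> * sin (pi * t) * w + \<xi> * cos (pi * t))"
        using \<xi>(2) unfolding half_plane_rotation_def
        by (metis (no_types, lifting) distrib_left mult.assoc mult_divide_mult_cancel_left right_diff_distrib)
      also have "\<dots> = ((\<xi> * \<xi> + 1) / 2 * w - (\<xi> * \<xi> - 1) / (2 * \<i>)) /
          ((\<xi> * \<xi> - 1) / (2 * \<i>) * w + (\<xi> * \<xi> + 1) / 2)"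
        by (simp only: CS)
      also have "\<dots> = (2 * ((\<xi> * \<xi> + 1) / 2 * w - (\<xi> * \<xi> - 1) / (2 * \<i>))) /
          (2 * ((\<xi> * \<xi> - 1) / (2 * \<i>) * w + (\<xi> * \<xi> + 1) / 2))"
        by (rule mult_divide_mult_cancel_left[symmetric]) simp
      also have "\<dots> = ((\<xi> * \<xi> + 1) * w + \<i> * (\<xi> * \<xi> - 1)) / (- \<i> * (\<xi> * \<xi> - 1) * w + (\<xi> * \<xi> + 1))"
        by (intro arg_cong2[where f = "(/)"]) (simp_all add: field_simps)
      also have "\<dots> = (\<i> * ((\<xi> * \<xi> + 1) * w + \<i> * (\<xi> * \<xi> - 1))) /
          (\<i> * (- \<i> * (\<xi> * \<xi> - 1) * w + (\<xi> * \<xi> + 1)))"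
        by simp
      also have "\<dots> = \<i> * (\<xi> * \<xi> * (w + \<i>) + (w - \<i>)) / (\<xi> * \<xi> * (w + \<i>) - (w - \<i>))"
        by (simp add: algebra_simps)
      also have "\<dots> = \<i> * ((\<xi> * \<xi> + c w) * (w + \<i>)) / ((\<xi> * \<xi> - c w) * (w + \<i>))"
      proof -
        have "c w * (w + \<i>) = w - \<i>" using nz by (simp add: c_def)
        then show ?thesis by (simp only: distrib_right left_diff_distrib)
      qed
      also have "\<dots> = \<i> * ((\<xi> * \<xi> + c w) / (\<xi> * \<xi> - c w))"
        using nz by simp
      finally show ?thesis unfolding \<xi>(1) by (simp add: mult_ac)
    qed
    moreover have "\<i> * (f (r n * c w) - \<i> * of_real (Im (f (of_real (r n) * 0)))) = \<i> * f (r n * c w) - Re (N \<i>)"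
      by (simp add: f_def h_def algebra_simps)
    ultimately show "((\<lambda>t. of_real (Re (f (r n * cis (2 * pi * t)))) *
        half_plane_rotation (cos (pi * t)) (sin (pi * t)) w) has_integral \<i> * f (r n * c w) - Re (N \<i>)) {0..1}"
      by simp
  next
    fix w assume w: "0 < Im (w :: complex)"
    have "isCont f (c w)"
      using f c(1)[OF w] holomorphic_on_imp_continuous_on[OF f]
      by (simp add: continuous_on_eq_continuous_at)
    moreover have "(\<lambda>n. of_real (r n) * c w) \<longlonglongrightarrow> of_real 1 * c w"
      by (intro tendsto_intros r_lim)
    ultimately have "(\<lambda>n. \<i> * f (r n * c w)) \<longlonglongrightarrow> \<i> * f (c w)"
      by (intro tendsto_mult[OF tendsto_const] isCont_tendsto_compose[where g = f]) auto
    then show "(\<lambda>n. \<i> * f (r n * c w)) \<longlonglongrightarrow> N w"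
      by (simp add: f_def c(2)[OF w])
  qed
qed

text \<open>Real-linear inequalities between finitely many values of a function pass from the rotations
  to all holomorphic self-maps of the half-plane.\<close>

lemma nevanlinna_principle:
  fixes cs :: "(complex \<times> complex) list"
  assumes "N holomorphic_on upper_half_plane" "\<And>z. 0 < Im z \<Longrightarrow> 0 \<le> Im (N z)"
    and pts: "\<And>c w. (c, w) \<in> set cs \<Longrightarrow> 0 < Im w"
    and const: "Re (\<Sum>(c, w)\<leftarrow>cs. c) = 0"
    and rot: "\<And>C S. C\<^sup>2 + S\<^sup>2 = 1 \<Longrightarrow> 0 \<le> Re (\<Sum>(c, w)\<leftarrow>cs. c * half_plane_rotation C S w)"
  shows "0 \<le> Re (\<Sum>(c, w)\<leftarrow>cs. c * N w)"
proof -
  obtain g and A :: "nat \<Rightarrow> complex \<Rightarrow> complex" where g: "\<And>n t. 0 \<le> g n t"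
    and int: "\<And>n w. 0 < Im w \<Longrightarrow> ((\<lambda>t. complex_of_real (g n t) * half_plane_rotation (cos (pi * t)) (sin (pi * t)) w)
      has_integral A n w - Re (N \<i>)) {0..1}"
    and lim: "\<And>w. 0 < Im w \<Longrightarrow> (\<lambda>n. A n w) \<longlonglongrightarrow> N w"
    by (rule nevanlinna_approximation[OF assms(1,2)]) (simp, rule that, assumption+)
  have "((\<lambda>t. of_real (g n t) * (\<Sum>(c, w)\<leftarrow>cs. c * half_plane_rotation (cos (pi * t)) (sin (pi * t)) w))
      has_integral (\<Sum>(c, w)\<leftarrow>cs. c * A n w) - (\<Sum>(c, w)\<leftarrow>cs. c) * of_real (Re (N \<i>))) {0..1}" for n
    using pts
  proof (induction cs)
    case (Cons x cs)
    obtain c w where x: "x = (c, w)" by fastforce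
    have "0 < Im w" using Cons.prems[of c w] by (simp add: x)
    from has_integral_add[OF has_integral_mult_right[OF int[OF this, of n], of c] Cons.IH[OF Cons.prems[OF list.set_intros(2)]]]
    show ?case by (simp add: x algebra_simps)
  qed auto
  then have "((\<lambda>t. Re (of_real (g n t) * (\<Sum>(c, w)\<leftarrow>cs. c * half_plane_rotation (cos (pi * t)) (sin (pi * t)) w)))
      has_integral Re ((\<Sum>(c, w)\<leftarrow>cs. c * A n w) - (\<Sum>(c, w)\<leftarrow>cs. c) * of_real (Re (N \<i>)))) {0..1}" for n
    using has_integral_linear[OF _ bounded_linear_Re, unfolded o_def] by blast
  then have "0 \<le> Re ((\<Sum>(c, w)\<leftarrow>cs. c * A n w) - (\<Sum>(c, w)\<leftarrow>cs. c) * of_real (Re (N \<i>)))" for n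
    by (rule has_integral_nonneg) (simp add: g rot)
  \<comment> \<open>The constant \<open>Re (N \<i>)\<close> is real, so it enters only through the
    real part of the sum of the coefficients, which is 0.\<close>
  then have "0 \<le> Re (\<Sum>(c, w)\<leftarrow>cs. c * A n w)" for n
    using const by simp
  moreover have "(\<lambda>n. Re (\<Sum>(c, w)\<leftarrow>cs. c * A n w)) \<longlonglongrightarrow> Re (\<Sum>(c, w)\<leftarrow>cs. c * N w)"
  proof (rule tendsto_Re)
    show "(\<lambda>n. \<Sum>(c, w)\<leftarrow>cs. c * A n w) \<longlonglongrightarrow> (\<Sum>(c, w)\<leftarrow>cs. c * N w)"
      using pts
    proof (induction cs)
      case (Cons x cs)
      then show ?case by (cases x) (auto intro!: tendsto_intros lim)
    qed auto
  qed
  ultimately show ?thesis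
    by (meson LIMSEQ_le_const)
qed

section \<open>Elementary estimates for the rotations\<close>

context
  fixes C S :: real
  assumes CS: "C\<^sup>2 + S\<^sup>2 = 1"
begin

lemma Im_half_plane_rotation:
  fixes w :: complex
  shows "Im (half_plane_rotation C S w) = Im w / (cmod (S * w + C))\<^sup>2"
proof -
  have "C * Im w * (S * Re w + C) - (C * Re w - S) * (S * Im w) = (C\<^sup>2 + S\<^sup>2) * Im w"
    by (simp add: power2_eq_square algebra_simps)
  then show ?thesis
    by (simp add: half_plane_rotation_def Im_divide cmod_power2 CS)
qed

lemma half_plane_rotation_diff:
  fixes v w :: complex
  assumes "0 < Im v" "0 < Im w"
  shows "half_plane_rotation C S v - half_plane_rotation C S w = (v - w) / ((S * v + C) * (S * w + C))"
proof -
  have "(C * v - S) * (S * w + C) - (C * w - S) * (S * v + C) = of_real (C\<^sup>2 + S\<^sup>2) * (v - w)"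
    by (simp add: power2_eq_square algebra_simps)
  then show ?thesis
    using half_plane_rotation_denom_nonzero[OF CS assms(1)] half_plane_rotation_denom_nonzero[OF CS assms(2)]
    by (simp add: half_plane_rotation_def diff_frac_eq CS)
qed

lemma half_plane_rotation_i: "half_plane_rotation C S \<i> = \<i>"
  using half_plane_rotation_denom_nonzero[OF CS, of \<i>]
  by (simp add: half_plane_rotation_def divide_eq_eq algebra_simps)

lemma half_plane_rotation_params: "\<bar>C\<bar> \<le> 1" "\<bar>S\<bar> \<le> 1"
proof -
  have "C\<^sup>2 \<le> 1" "S\<^sup>2 \<le> 1"
    using CS zero_le_power2[of C] zero_le_power2[of S] by linarith+
  then show "\<bar>C\<bar> \<le> 1" "\<bar>S\<bar> \<le> 1"
    by (simp_all add: abs_square_le_1)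
qed

lemma cmod_half_plane_rotation_denom_le:
  fixes w :: complex
  shows "cmod (S * w + C) \<le> 1 + cmod w"
proof -
  have "cmod (S * w + C) \<le> \<bar>S\<bar> * cmod w + \<bar>C\<bar>"
    using norm_triangle_ineq[of "of_real S * w" "of_real C"] by (simp add: norm_mult)
  also have "\<dots> \<le> 1 * cmod w + 1"
    by (intro add_mono mult_right_mono half_plane_rotation_params) auto
  finally show ?thesis by simp
qed

text \<open>The matrix of the rotation has determinant 1, so numerator times conjugate denominator
  has imaginary part \<open>Im w\<close>; the numerator has modulus at most
  \<open>1 + cmod w\<close>.\<close>

lemma cmod_half_plane_rotation_denom_ge:
  fixes w :: complex
  assumes "0 < Im w"
  shows "Im w \<le> (1 + cmod w) * cmod (S * w + C)"
proof -
  have "cmod (C * w - S) \<le> \<bar>C\<bar> * cmod w + \<bar>S\<bar>"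
    using norm_triangle_ineq4[of "of_real C * w" "of_real S"] by (simp add: norm_mult)
  also have "\<dots> \<le> 1 * cmod w + 1"
    by (intro add_mono mult_right_mono half_plane_rotation_params) auto
  finally have le: "cmod (C * w - S) \<le> 1 + cmod w" by simp
  have "Im ((C * w - S) * cnj (S * w + C)) = (C\<^sup>2 + S\<^sup>2) * Im w"
    by (simp add: algebra_simps power2_eq_square)
  then have "Im w = Im ((C * w - S) * cnj (S * w + C))"
    by (simp add: CS)
  also have "\<dots> \<le> cmod ((C * w - S) * cnj (S * w + C))"
    using abs_Im_le_cmod abs_le_D1 by blast
  also have "\<dots> = cmod (C * w - S) * cmod (S * w + C)"
    by (simp only: norm_mult complex_mod_cnj)
  also have "\<dots> \<le> (1 + cmod w) * cmod (S * w + C)"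
    by (intro mult_right_mono le) auto
  finally show ?thesis .
qed

end

section \<open>The distance of a self-map from the affine maps\<close>

text \<open>A functional admissible in \<open>nevanlinna_principle\<close>. On rotations it is
  comparable to \<open>S\<^sup>2\<close>, so it vanishes there only for \<open>S = 0\<close>, the
  identity map; on general self-maps it weighs the part of the representation away from the linear
  term.\<close>

definition affine_defect :: "(complex \<Rightarrow> complex) \<Rightarrow> real" where
  "affine_defect N = Im (N \<i>) - Im (N (2 * \<i>)) / 2"

lemma affine_defect_half_plane_rotation:
  assumes "C\<^sup>2 + S\<^sup>2 = 1"
  shows "affine_defect (half_plane_rotation C S) = 3 * S\<^sup>2 / (1 + 3 * S\<^sup>2)"
proof -
  have "(cmod (S * (2 * \<i>) + C))\<^sup>2 = 1 + 3 * S\<^sup>2"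
    using assms unfolding cmod_power2 by (simp add: power2_eq_square)
  moreover have "1 + 3 * S\<^sup>2 > 0" by (simp add: add_pos_nonneg)
  ultimately show ?thesis
    by (simp add: affine_defect_def half_plane_rotation_i[OF assms] Im_half_plane_rotation[OF assms] field_simps)
qed

lemma affine_defect_half_plane_rotation_bounds:
  assumes "C\<^sup>2 + S\<^sup>2 = 1"
  shows "0 \<le> affine_defect (half_plane_rotation C S)" "affine_defect (half_plane_rotation C S) \<le> 3 * S\<^sup>2"
    "S\<^sup>2 \<le> 2 * affine_defect (half_plane_rotation C S)"
proof -
  have "S\<^sup>2 \<le> 1" using assms by (smt (verit) zero_le_power2)
  have p: "1 + 3 * S\<^sup>2 > 0" by (simp add: add_pos_nonneg)
  show "0 \<le> affine_defect (half_plane_rotation C S)"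
    by (simp add: affine_defect_half_plane_rotation[OF assms])
  have "3 * S\<^sup>2 * 1 \<le> 3 * S\<^sup>2 * (1 + 3 * S\<^sup>2)" by (intro mult_left_mono) auto
  then show "affine_defect (half_plane_rotation C S) \<le> 3 * S\<^sup>2"
    using p by (simp add: affine_defect_half_plane_rotation[OF assms] pos_divide_le_eq)
  have "S\<^sup>2 * (1 + 3 * S\<^sup>2) \<le> S\<^sup>2 * 6"
    using \<open>S\<^sup>2 \<le> 1\<close> by (intro mult_left_mono) auto
  then show "S\<^sup>2 \<le> 2 * affine_defect (half_plane_rotation C S)"
    using p by (simp add: affine_defect_half_plane_rotation[OF assms] pos_le_divide_eq)
qed

section \<open>Inequalities for holomorphic self-maps of the half-plane\<close>

context
  fixes N :: "complex \<Rightarrow> complex"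
  assumes N: "N holomorphic_on upper_half_plane" "\<And>z. 0 < Im z \<Longrightarrow> 0 \<le> Im (N z)"
begin

lemma affine_defect_nonneg: "0 \<le> affine_defect N"
proof -
  have "0 \<le> Re (\<Sum>(c, w)\<leftarrow>[(- \<i>, \<i>), (\<i> / 2, 2 * \<i>)]. c * N w)"
  proof (rule nevanlinna_principle[OF N])
    fix C S :: real assume "C\<^sup>2 + S\<^sup>2 = 1"
    from affine_defect_half_plane_rotation_bounds(1)[OF this]
    show "0 \<le> Re (\<Sum>(c, w)\<leftarrow>[(- \<i>, \<i>), (\<i> / 2, 2 * \<i>)]. c * half_plane_rotation C S w)"
      by (simp add: affine_defect_def)
  qed auto
  then show ?thesis by (simp add: affine_defect_def)
qed

text \<open>Harnack's inequality with base point \<open>\<i>\<close>. Every rotation fixes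
  \<open>\<i>\<close>, and its denominator at \<open>w\<close> is at most
  \<open>1 + cmod w\<close>.\<close>

lemma Im_ge_of_Im_at_i:
  assumes "0 < Im w"
  shows "Im (N \<i>) * (Im w / (1 + cmod w)\<^sup>2) \<le> Im (N w)"
proof -
  define a where "a = Im w / (1 + cmod w)\<^sup>2"
  have "0 \<le> Re (\<Sum>(c, w)\<leftarrow>[(- \<i>, w), (\<i> * of_real a, \<i>)]. c * N w)"
  proof (rule nevanlinna_principle[OF N])
    fix C S :: real assume CS: "C\<^sup>2 + S\<^sup>2 = 1"
    have "a \<le> Im w / (cmod (S * w + C))\<^sup>2"
    proof -
      have "(cmod (S * w + C))\<^sup>2 \<le> (1 + cmod w)\<^sup>2"
        by (intro power_mono cmod_half_plane_rotation_denom_le[OF CS]) auto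
      moreover have "0 < (cmod (S * w + C))\<^sup>2"
        using half_plane_rotation_denom_nonzero[OF CS assms] by simp
      ultimately show ?thesis
        unfolding a_def using assms by (intro divide_left_mono mult_pos_pos) auto
    qed
    then show "0 \<le> Re (\<Sum>(c, w)\<leftarrow>[(- \<i>, w), (\<i> * of_real a, \<i>)]. c * half_plane_rotation C S w)"
      by (simp add: half_plane_rotation_i[OF CS] Im_half_plane_rotation[OF CS])
  qed (use assms in auto)
  then show ?thesis by (simp add: a_def mult.commute)
qed

text \<open>Harnack's inequality in a form adapted to \<open>w\<close> approaching the real point
  \<open>u\<close>: the factor then tends to 1, so a bound on \<open>Im (N w) / Im w\<close> is
  carried to the vertical line above \<open>u\<close> without loss.\<close>

lemma Im_quotient_le:
  assumes w: "0 < Im w" and y: "0 < y"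
  shows "Im (N (Complex u y)) / y \<le> (1 + cmod (w - of_real u) / y)\<^sup>2 * (Im (N w) / Im w)"
proof -
  define q where "q = 1 + cmod (w - of_real u) / y"
  have "0 \<le> Re (\<Sum>(c, w)\<leftarrow>[(- \<i> * of_real (q\<^sup>2 / Im w), w), (\<i> * of_real (1 / y), Complex u y)]. c * N w)"
  proof (rule nevanlinna_principle[OF N])
    fix C S :: real assume CS: "C\<^sup>2 + S\<^sup>2 = 1"
    define d where "d = cmod (S * Complex u y + C)"
    have d: "0 < d"
      using half_plane_rotation_denom_nonzero[OF CS, of "Complex u y"] y by (simp add: d_def)
    have dw: "0 < cmod (S * w + C)"
      using half_plane_rotation_denom_nonzero[OF CS w] by simp
    \<comment> \<open>The two left-hand sides are the absolute values of the real and imaginary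
      parts of the denominator at \<open>Complex u y\<close>.\<close>
    have "\<bar>S * u + C\<bar> \<le> d" "\<bar>S\<bar> * y \<le> d"
      using abs_Re_le_cmod[of "S * Complex u y + C"] abs_Im_le_cmod[of "S * Complex u y + C"] y
      by (simp_all add: d_def abs_mult)
    have "S * w + C = of_real (S * u + C) + S * (w - of_real u)"
      by (simp add: algebra_simps)
    then have "cmod (S * w + C) \<le> \<bar>S * u + C\<bar> + \<bar>S\<bar> * cmod (w - of_real u)"
      using norm_triangle_ineq[of "of_real (S * u + C)" "of_real S * (w - of_real u)"]
      by (simp only: norm_mult norm_of_real)
    also have "\<bar>S\<bar> * cmod (w - of_real u) = \<bar>S\<bar> * y * (cmod (w - of_real u) / y)"
      using y by simp
    also have "\<bar>S * u + C\<bar> + \<bar>S\<bar> * y * (cmod (w - of_real u) / y) \<le> d + d * (cmod (w - of_real u) / y)"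
      using \<open>\<bar>S * u + C\<bar> \<le> d\<close> \<open>\<bar>S\<bar> * y \<le> d\<close> y by (intro add_mono mult_right_mono) auto
    also have "\<dots> = q * d" by (simp add: q_def algebra_simps)
    finally have "(cmod (S * w + C))\<^sup>2 \<le> (q * d)\<^sup>2" by (intro power_mono) auto
    then have "1 / d\<^sup>2 \<le> q\<^sup>2 / (cmod (S * w + C))\<^sup>2"
      using d dw by (simp add: field_simps power_mult_distrib)
    then show "0 \<le> Re (\<Sum>(c, w)\<leftarrow>[(- \<i> * of_real (q\<^sup>2 / Im w), w), (\<i> * of_real (1 / y), Complex u y)].
        c * half_plane_rotation C S w)"
      using w y by (simp add: Im_half_plane_rotation[OF CS] d_def)
  next
    show "Re (\<Sum>(c, w)\<leftarrow>[(- \<i> * of_real (q\<^sup>2 / Im w), w), (\<i> * of_real (1 / y), Complex u y)]. c) = 0"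
      by simp
  qed (use w y in auto)
  then show ?thesis by (simp add: q_def)
qed

text \<open>A rotation differs from the identity at \<open>w\<close> by at most a multiple of
  \<open>\<bar>S\<bar>\<close>, whereas its defect only controls \<open>S\<^sup>2\<close>. Bounding
  \<open>\<bar>S\<bar>\<close> by \<open>\<epsilon>\<close> plus a multiple of
  \<open>S\<^sup>2 / \<epsilon>\<close> makes \<open>nevanlinna_principle\<close> applicable, and
  \<open>\<epsilon>\<close> then tends to 0.\<close>

lemma affine_if_affine_defect_eq_0:
  assumes D: "affine_defect N = 0" and w: "0 < Im w"
  shows "N w = of_real (Re (N \<i>)) + of_real (Im (N \<i>)) * w"
proof -
  define A where "A = cmod (1 + w\<^sup>2) * (1 + cmod w) / Im w"
  have A: "0 \<le> A" using w by (simp add: A_def)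
  define d where "d = N w - of_real (Re (N \<i>)) - of_real (Im (N \<i>)) * w"
  \<comment> \<open>With this choice \<open>Re (u * d)\<close> is the square of
    \<open>cmod d\<close>.\<close>
  define u where "u = cnj d"
  have "Re (u * d) \<le> 0 + \<epsilon> * (cmod u * A * Im (N \<i>))" if "0 < \<epsilon>" for \<epsilon>
  proof -
    define B where "B = cmod u * A"
    \<comment> \<open>The coefficients are read off from \<open>eval\<close>; for rotations
      \<open>Im (f \<i>)\<close> is 1, so the first term there contributes
      \<open>B * \<epsilon>\<close>.\<close>
    define cs where "cs = [(- u, w), (of_real (Re u) - \<i> * of_real (Re (u * w)) - \<i> * of_real (B * (\<epsilon> + 2 / \<epsilon>)), \<i>),
      (\<i> * of_real (B / \<epsilon>), 2 * \<i>)]"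
    have eval: "Re (\<Sum>(c, w)\<leftarrow>cs. c * f w) = B * (\<epsilon> * Im (f \<i>) + 2 * affine_defect f / \<epsilon>)
        - Re (u * (f w - of_real (Re (f \<i>)) - of_real (Im (f \<i>)) * w))" for f
      by (simp add: cs_def affine_defect_def algebra_simps add_divide_distrib diff_divide_distrib)
    have "0 \<le> Re (\<Sum>(c, w)\<leftarrow>cs. c * N w)"
    proof (rule nevanlinna_principle[OF N])
      fix C S :: real assume CS: "C\<^sup>2 + S\<^sup>2 = 1"
      let ?R = "half_plane_rotation C S"
      have nz: "S * w + C \<noteq> 0" by (rule half_plane_rotation_denom_nonzero[OF CS w])
      have "?R w - w = - S * (1 + w\<^sup>2) / (S * w + C)"
        using nz by (simp add: half_plane_rotation_def field_simps power2_eq_square)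
      then have "cmod (?R w - w) = \<bar>S\<bar> * (cmod (1 + w\<^sup>2) / cmod (S * w + C))"
        by (simp add: norm_divide norm_mult)
      also have "\<dots> \<le> \<bar>S\<bar> * A"
      proof (intro mult_left_mono)
        have "cmod (1 + w\<^sup>2) * Im w \<le> cmod (1 + w\<^sup>2) * ((1 + cmod w) * cmod (S * w + C))"
          by (intro mult_left_mono cmod_half_plane_rotation_denom_ge[OF CS w]) auto
        then show "cmod (1 + w\<^sup>2) / cmod (S * w + C) \<le> A"
          using nz w by (simp add: A_def divide_simps mult_ac)
      qed auto
      also have "\<dots> \<le> (\<epsilon> + 2 * affine_defect ?R / \<epsilon>) * A"
      proof (intro mult_right_mono A)
        have "(\<epsilon> - \<bar>S\<bar>)\<^sup>2 = \<epsilon>\<^sup>2 + S\<^sup>2 - 2 * (\<bar>S\<bar> * \<epsilon>)"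
          by (simp add: power2_diff)
        moreover have "0 \<le> (\<epsilon> - \<bar>S\<bar>)\<^sup>2" "0 \<le> \<bar>S\<bar> * \<epsilon>"
          using that by simp_all
        ultimately have "\<bar>S\<bar> * \<epsilon> \<le> \<epsilon>\<^sup>2 + S\<^sup>2"
          by linarith
        also have "\<dots> \<le> \<epsilon>\<^sup>2 + 2 * affine_defect ?R"
          using affine_defect_half_plane_rotation_bounds(3)[OF CS] by simp
        finally show "\<bar>S\<bar> \<le> \<epsilon> + 2 * affine_defect ?R / \<epsilon>"
          using that by (simp add: field_simps power2_eq_square)
      qed
      finally have "cmod u * cmod (?R w - w) \<le> cmod u * ((\<epsilon> + 2 * affine_defect ?R / \<epsilon>) * A)"
        by (intro mult_left_mono) auto
      moreover have "Re (u * (?R w - w)) \<le> cmod u * cmod (?R w - w)"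
        using complex_Re_le_cmod[of "u * (?R w - w)"] by (simp only: norm_mult)
      ultimately show "0 \<le> Re (\<Sum>(c, w)\<leftarrow>cs. c * ?R w)"
        unfolding eval by (simp add: half_plane_rotation_i[OF CS] B_def mult_ac)
    next
      show "Re (\<Sum>(c, w)\<leftarrow>cs. c) = 0" by (simp add: cs_def)
    qed (use w in \<open>auto simp: cs_def\<close>)
    then show ?thesis
      unfolding eval using D by (simp add: d_def B_def mult_ac)
  qed
  note * = this
  have "Re (u * d) \<le> 0"
  proof (rule field_le_epsilon)
    fix e :: real assume "0 < e"
    define K where "K = cmod u * A * Im (N \<i>)"
    have K: "0 \<le> K" using A N(2)[of \<i>] by (simp add: K_def)
    \<comment> \<open>The added 1 keeps the divisor positive even if \<open>K = 0\<close>.\<close>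
    have "Re (u * d) \<le> e / (K + 1) * K"
      using *[of "e / (K + 1)"] \<open>0 < e\<close> K by (simp add: K_def)
    also have "\<dots> \<le> e"
      using \<open>0 < e\<close> K by (simp add: field_simps)
    finally show "Re (u * d) \<le> 0 + e" by simp
  qed
  then have "(cmod d)\<^sup>2 \<le> 0"
    unfolding cmod_power2 by (simp add: u_def power2_eq_square)
  then show ?thesis by (simp add: d_def algebra_simps)
qed

text \<open>For a rotation the right-hand side is \<open>\<bar>1 / (S v + C) - cnj (1 / (S w + C))\<bar>\<^sup>2 / 2\<close>.\<close>

lemma schwarz_pick_defect:
  assumes v: "0 < Im v" and w: "0 < Im w" and "v \<noteq> w"
  shows "affine_defect N / 6 * ((cmod (v - w))\<^sup>2 / ((1 + cmod v)\<^sup>2 * (1 + cmod w)\<^sup>2)) \<le>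
    (Im (N v) / Im v + Im (N w) / Im w) / 2 - Re ((N v - N w) / (v - w))"
proof -
  define k where "k = (cmod (v - w))\<^sup>2 / ((1 + cmod v)\<^sup>2 * (1 + cmod w)\<^sup>2)"
  have k: "0 \<le> k" by (simp add: k_def)
  define cs where "cs = [(- \<i> * of_real (1 / (2 * Im v)) - 1 / (v - w), v),
    (- \<i> * of_real (1 / (2 * Im w)) + 1 / (v - w), w),
    (\<i> * of_real (k / 6), \<i>), (- \<i> * of_real (k / 12), 2 * \<i>)]"
  have eval: "Re (\<Sum>(c, w)\<leftarrow>cs. c * f w) = (Im (f v) / Im v + Im (f w) / Im w) / 2 -
      Re ((f v - f w) / (v - w)) - affine_defect f / 6 * k" for f
    by (simp add: cs_def affine_defect_def algebra_simps diff_divide_distrib add_divide_distrib)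
  have "0 \<le> Re (\<Sum>(c, w)\<leftarrow>cs. c * N w)"
  proof (rule nevanlinna_principle[OF N])
    fix C S :: real assume CS: "C\<^sup>2 + S\<^sup>2 = 1"
    let ?R = "half_plane_rotation C S"
    define a b where "a = S * v + C" and "b = S * w + C"
    have nz: "a \<noteq> 0" "b \<noteq> 0"
      using half_plane_rotation_denom_nonzero[OF CS] v w by (auto simp: a_def b_def)
    have quot: "(?R v - ?R w) / (v - w) = 1 / a * (1 / b)"
      using \<open>v \<noteq> w\<close> by (simp add: half_plane_rotation_diff[OF CS v w] a_def b_def)
    \<comment> \<open>For \<open>x = 1 / a\<close> and \<open>y = 1 / b\<close> the squared moduli
      are the ratios of imaginary parts, and \<open>x * y\<close> is the difference quotient of the
      rotation.\<close>
    have polar: "((cmod x)\<^sup>2 + (cmod y)\<^sup>2) / 2 - Re (x * y) = (cmod (x - cnj y))\<^sup>2 / 2" for x y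
      unfolding cmod_power2 by (simp add: power2_eq_square algebra_simps add_divide_distrib diff_divide_distrib)
    \<comment> \<open>The constant 6 comes from the bound \<open>3 * S\<^sup>2\<close> for the
      defect, which leaves the factor 1/2 of the polarization identity.\<close>
    have "affine_defect ?R / 6 * k \<le> S\<^sup>2 / 2 * k"
      using affine_defect_half_plane_rotation_bounds(2)[OF CS] k by (intro mult_right_mono) auto
    also have "\<dots> = (S\<^sup>2 * (cmod (v - w))\<^sup>2) / ((1 + cmod v)\<^sup>2 * (1 + cmod w)\<^sup>2) / 2"
      by (simp add: k_def)
    also have "\<dots> \<le> (S\<^sup>2 * (cmod (v - cnj w))\<^sup>2) / ((cmod a)\<^sup>2 * (cmod b)\<^sup>2) / 2"
    proof (intro divide_right_mono frac_le)
      have "(Im v - Im w)\<^sup>2 \<le> (Im v + Im w)\<^sup>2"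
        using v w by (simp add: power2_eq_square algebra_simps)
      then have "(cmod (v - w))\<^sup>2 \<le> (cmod (v - cnj w))\<^sup>2"
        unfolding cmod_power2 by simp
      then show "S\<^sup>2 * (cmod (v - w))\<^sup>2 \<le> S\<^sup>2 * (cmod (v - cnj w))\<^sup>2"
        by (intro mult_left_mono) auto
      show "(cmod a)\<^sup>2 * (cmod b)\<^sup>2 \<le> (1 + cmod v)\<^sup>2 * (1 + cmod w)\<^sup>2"
        unfolding a_def b_def
        by (intro mult_mono power_mono cmod_half_plane_rotation_denom_le[OF CS]) auto
    qed (use nz in auto)
    also have "\<dots> = (cmod (1 / a - cnj (1 / b)))\<^sup>2 / 2"
    proof -
      have "1 / a - cnj (1 / b) = (cnj b - a) / (a * cnj b)"
        using nz by (simp add: field_simps)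
      also have "cnj b - a = - of_real S * (v - cnj w)"
        by (simp add: a_def b_def algebra_simps)
      finally show ?thesis
        by (simp add: norm_divide norm_mult power_divide power_mult_distrib)
    qed
    also have "\<dots> = ((cmod (1 / a))\<^sup>2 + (cmod (1 / b))\<^sup>2) / 2 - Re (1 / a * (1 / b))"
      by (simp only: polar)
    also have "\<dots> = (Im (?R v) / Im v + Im (?R w) / Im w) / 2 - Re ((?R v - ?R w) / (v - w))"
      unfolding quot using v w
      by (simp add: Im_half_plane_rotation[OF CS] a_def b_def norm_divide power_divide)
    finally show "0 \<le> Re (\<Sum>(c, w)\<leftarrow>cs. c * ?R w)"
      unfolding eval by simp
  next
    show "Re (\<Sum>(c, w)\<leftarrow>cs. c) = 0" by (simp add: cs_def)
  qed (use v w in \<open>auto simp: cs_def\<close>)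
  then show ?thesis unfolding eval by (simp add: k_def)
qed

end

section \<open>The Voiculescu transform of an infinitely divisible measure\<close>

text \<open>Provides the accumulation point for the identity theorem when an equation is known only
  along a curve.\<close>

lemma islimpt_curve:
  fixes X :: "real \<Rightarrow> complex"
  assumes "a < b" "isCont X b" "\<And>y. a < y \<Longrightarrow> X y = X b \<Longrightarrow> y = b"
  shows "X b islimpt X ` {a<..}"
  unfolding islimpt_sequential
proof (intro exI conjI allI)
  have "(\<lambda>n. b + 1 / real (Suc n)) \<longlonglongrightarrow> b + 0"
    by (intro tendsto_intros LIMSEQ_inverse_real_of_nat[unfolded inverse_eq_divide])
  then show "(\<lambda>n. X (b + 1 / real (Suc n))) \<longlonglongrightarrow> X b"
    using isCont_tendsto_compose[OF assms(2)] by simp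
  fix n
  have "a < b + 1 / real (Suc n)" "b + 1 / real (Suc n) \<noteq> b"
    using \<open>a < b\<close> by (auto intro: less_trans)
  then show "X (b + 1 / real (Suc n)) \<in> X ` {a<..} - {X b}"
    using assms(3) by blast
qed

lemma nontangential_in_ball:
  assumes "((\<lambda>y. X y / (\<i> * of_real y)) \<longlongrightarrow> 1) at_top"
  shows "\<forall>\<^sub>F y in at_top. X y \<in> ball (\<i> * of_real y) (y / 2)"
proof -
  have "\<forall>\<^sub>F y in at_top. dist (X y / (\<i> * of_real y)) 1 < 1 / 2"
    using tendstoD[OF assms, of "1/2"] by simp
  then show ?thesis
    using eventually_gt_at_top[of 0]
  proof eventually_elim
    case (elim y)
    have "X y - \<i> * of_real y = (X y / (\<i> * of_real y) - 1) * (\<i> * of_real y)"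
      using elim by (simp add: field_simps)
    then have "cmod (X y - \<i> * of_real y) = cmod (X y / (\<i> * of_real y) - 1) * y"
      using elim by (simp add: norm_mult)
    also have "\<dots> < 1 / 2 * y"
      using elim by (intro mult_strict_right_mono) (auto simp: dist_norm)
    finally show ?case by (simp add: dist_norm norm_minus_commute)
  qed
qed

lemma F_inverse_on_eventually_in:
  "F_inverse_on \<mu> U \<phi> \<Longrightarrow> \<forall>\<^sub>F y in at_top. \<i> * of_real y \<in> U"
  unfolding F_inverse_on_def eventually_at_top_dense by blast

text \<open>For large \<open>y\<close> both points lie in the ball on which the F-transform is
  injective, and both are mapped to \<open>\<i> * of_real y\<close>. This is where the asymptotic
  condition singles out the branch.\<close>

lemma F_inverse_on_eventually_eq:
  assumes "real_distribution \<mu>" and \<phi>: "F_inverse_on \<mu> U \<phi>"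
    and X: "((\<lambda>y. X y / (\<i> * of_real y)) \<longlongrightarrow> 1) at_top"
    and F: "\<forall>\<^sub>F y in at_top. F_transform \<mu> (X y) = \<i> * of_real y"
  shows "\<forall>\<^sub>F y in at_top. X y = \<phi> (\<i> * of_real y)"
proof -
  interpret real_distribution \<mu> by fact
  have "((\<lambda>y. \<phi> (\<i> * of_real y) / (\<i> * of_real y)) \<longlongrightarrow> 1) at_top"
    using \<phi> by (simp add: F_inverse_on_def)
  from nontangential_in_ball[OF this] nontangential_in_ball[OF X] inj_on_F_transform_near_infinity
    F_inverse_on_eventually_in[OF \<phi>] F
  show ?thesis
  proof eventually_elim
    case (elim y)
    then show ?case
      using \<phi> by (auto simp: F_inverse_on_def intro: inj_onD[OF elim(3)])
  qed
qed

lemma F_inverse_on_unique: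
  assumes "real_distribution \<mu>" "F_inverse_on \<mu> U \<phi>" "F_inverse_on \<mu> V \<psi>"
  shows "\<forall>\<^sub>F y in at_top. \<phi> (\<i> * of_real y) = \<psi> (\<i> * of_real y)"
  using F_inverse_on_eventually_in[OF assms(2)] assms(2)
  by (intro F_inverse_on_eventually_eq[OF assms(1,3)])
    (auto simp: F_inverse_on_def elim: eventually_mono)

text \<open>The Voiculescu transform \<open>\<phi> z - z\<close> is additive under free convolution.
  Each convolution brings its own domain and inverses, and \<open>F_inverse_on_unique\<close>
  identifies these far up the imaginary axis.\<close>

lemma free_convolution_power_voiculescu:
  assumes "free_convolution_power \<nu> n \<kappa>" "F_inverse_on \<nu> V \<psi>" "F_inverse_on \<kappa> U \<phi>"
  shows "\<forall>\<^sub>F y in at_top. \<phi> (\<i> * of_real y) - \<i> * of_real y = of_nat n * (\<psi> (\<i> * of_real y) - \<i> * of_real y)"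
  using assms
proof (induction arbitrary: U \<phi> rule: free_convolution_power.induct)
  case one
  show ?case
    using F_inverse_on_unique[OF one(1,3,2)] by eventually_elim simp
next
  case (Suc n \<kappa> \<mu>)
  obtain W \<phi>' \<phi>1 \<phi>2 where W: "F_inverse_on \<mu> W \<phi>'" "F_inverse_on \<kappa> W \<phi>1" "F_inverse_on \<nu> W \<phi>2"
    and sum: "\<forall>z\<in>W. z + \<phi>' z = \<phi>1 z + \<phi>2 z"
    and distr: "real_distribution \<mu>" "real_distribution \<nu>"
    using Suc.hyps(2) unfolding is_free_convolution_def by blast
  show ?case
    using F_inverse_on_unique[OF distr(1) Suc.prems(2) W(1)] F_inverse_on_unique[OF distr(2) Suc.prems(1) W(3)]
      F_inverse_on_eventually_in[OF W(1)] Suc.IH[OF Suc.prems(1) W(2)]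
  proof eventually_elim
    case (elim y)
    have "\<i> * of_real y + \<phi> (\<i> * of_real y) = \<phi>1 (\<i> * of_real y) + \<psi> (\<i> * of_real y)"
      using sum elim by auto
    then have "\<phi> (\<i> * of_real y) - \<i> * of_real y =
        (\<phi>1 (\<i> * of_real y) - \<i> * of_real y) + (\<psi> (\<i> * of_real y) - \<i> * of_real y)"
      by (simp add: algebra_simps)
    also have "\<dots> = of_nat (Suc n) * (\<psi> (\<i> * of_real y) - \<i> * of_real y)"
      by (simp add: elim algebra_simps)
    finally show ?case .
  qed
qed

text \<open>From the second power on, the last convolution carries an inverse for
  \<open>\<nu>\<close>; the rule \<open>one\<close> records none.\<close>

lemma free_convolution_power_F_inverse:
  assumes "free_convolution_power \<nu> n \<kappa>" "2 \<le> n"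
  obtains V \<psi> where "real_distribution \<nu>" "F_inverse_on \<nu> V \<psi>"
  using assms
proof cases
  case (Suc m \<kappa>')
  then show ?thesis using that unfolding is_free_convolution_def by blast
qed auto

text \<open>The functions \<open>n (F\<^bsub>\<nu>\<^esub> - id)\<close>, with \<open>\<nu>\<close> an \<open>n\<close>-th free convolution root, map the half-plane to
  its closure, so that Montel's theorem applies after a Cayley transform. Every limit extends
  \<open>id - \<phi>\<close>, since \<open>n (F\<^bsub>\<nu>\<^esub> - id)\<close> takes the value \<open>z - \<phi> z\<close> at \<open>z + (\<phi> z - z) / n\<close>.\<close>

lemma voiculescu_transform_extension:
  assumes "freely_infinitely_divisible \<kappa>" "F_inverse_on \<kappa> U \<phi>"
  obtains N where "N holomorphic_on upper_half_plane" "\<And>z. 0 < Im z \<Longrightarrow> 0 \<le> Im (N z)"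
    "\<forall>\<^sub>F y in at_top. \<phi> (\<i> * of_real y) = \<i> * of_real y - N (\<i> * of_real y)"
proof -
  obtain \<beta> where \<beta>: "0 < \<beta>" "\<And>y. y > \<beta> \<Longrightarrow> \<i> * of_real y \<in> U" and "open U" and \<phi>: "\<phi> holomorphic_on U"
    and \<phi>_im: "\<And>z. z \<in> U \<Longrightarrow> 0 < Im (\<phi> z)"
    using assms(2) unfolding F_inverse_on_def by auto
  define z0 where "z0 = \<i> * of_real (\<beta> + 1)"
  \<comment> \<open>\<open>U\<close> may be disconnected or leave the half-plane. The component
    containing the ray is a domain on which the identity theorem applies.\<close>
  define V where "V = connected_component_set (U \<inter> upper_half_plane) z0"
  have V: "open V" "connected V" "V \<subseteq> U" "V \<subseteq> upper_half_plane"
    using connected_component_subset[of "U \<inter> upper_half_plane" z0] \<open>open U\<close> open_upper_half_plane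
    by (auto simp: V_def intro!: open_connected_component)
  have ray: "\<i> * of_real y \<in> V" if "\<beta> < y" for y
  proof -
    have "connected ((\<lambda>y. \<i> * complex_of_real y) ` {\<beta><..})"
      by (intro connected_continuous_image continuous_intros) auto
    moreover have "(\<lambda>y. \<i> * complex_of_real y) ` {\<beta><..} \<subseteq> U \<inter> upper_half_plane"
      using \<beta> by auto
    moreover have "z0 \<in> (\<lambda>y. \<i> * complex_of_real y) ` {\<beta><..}"
      unfolding z0_def by (intro imageI) auto
    ultimately have "(\<lambda>y. \<i> * complex_of_real y) ` {\<beta><..} \<subseteq> V"
      unfolding V_def by (intro connected_component_maximal) auto
    then show ?thesis using that by auto
  qed
  \<comment> \<open>On the far part of the ray this is the inverse F-transform of a free convolution
    root of order \<open>n + 2\<close>. The shift by 2 guarantees that the root comes with an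
    inverse.\<close>
  define v where "v n z = z + (\<phi> z - z) / of_nat (n + 2)" for n :: nat and z
  \<comment> \<open>\<open>v n z\<close> is a convex combination of \<open>z\<close> and
    \<open>\<phi> z\<close>, both in the half-plane.\<close>
  have v: "0 < Im (v n z)" if "z \<in> V" for n z
  proof -
    have "0 < Im z" "0 < Im (\<phi> z)" using that V \<phi>_im by auto
    then have "0 < Im z * (1 + real n) + Im (\<phi> z)"
      by (intro add_nonneg_pos mult_nonneg_nonneg) auto
    also have "\<dots> = Im (v n z) * (real n + 2)"
      by (simp add: v_def Im_divide_of_nat field_simps del: of_nat_add)
    finally show ?thesis by (simp add: zero_less_mult_iff)
  qed
  have "\<exists>\<nu>. real_distribution \<nu> \<and> (\<forall>z\<in>V. F_transform \<nu> (v n z) = z)" for n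
  proof -
    obtain \<nu> where \<nu>: "free_convolution_power \<nu> (n + 2) \<kappa>"
      using assms(1) by (auto simp: freely_infinitely_divisible_def)
    then obtain W \<psi> where W: "real_distribution \<nu>" "F_inverse_on \<nu> W \<psi>"
      using free_convolution_power_F_inverse by (metis le_add2)
    interpret real_distribution \<nu> by fact
    have "\<forall>\<^sub>F y in at_top. F_transform \<nu> (v n (\<i> * of_real y)) = \<i> * of_real y"
      using free_convolution_power_voiculescu[OF \<nu> W(2) assms(2)] F_inverse_on_eventually_in[OF W(2)]
    proof eventually_elim
      case (elim y)
      have "(of_nat (n + 2) :: complex) \<noteq> 0"
        by (simp only: of_nat_eq_0_iff)
      then have "v n (\<i> * of_real y) = \<psi> (\<i> * of_real y)"
        by (simp only: v_def elim(1) nonzero_mult_div_cancel_left) simp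
      then show ?case using elim W(2) by (simp add: F_inverse_on_def)
    qed
    then obtain B where B: "\<And>y. y > B \<Longrightarrow> F_transform \<nu> (v n (\<i> * of_real y)) = \<i> * of_real y"
      by (auto simp: eventually_at_top_dense)
    define b where "b = max \<beta> B"
    \<comment> \<open>The equation is known on the ray beyond \<open>b\<close> and spreads over
      \<open>V\<close> by the identity theorem.\<close>
    have "F_transform \<nu> (v n z) - z = 0" if "z \<in> V" for z
    proof (rule analytic_continuation[where f = "\<lambda>z. F_transform \<nu> (v n z) - z" and S = V
          and U = "(\<lambda>y. \<i> * complex_of_real y) ` {b<..}" and \<xi> = "\<i> * of_real (b + 1)"])
      have "v n holomorphic_on V"
        unfolding v_def[abs_def] using \<phi> V by (intro holomorphic_intros) (auto intro: holomorphic_on_subset)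
      then show "(\<lambda>z. F_transform \<nu> (v n z) - z) holomorphic_on V"
        using v by (intro holomorphic_intros
            holomorphic_on_compose_gen[OF _ holomorphic_F_transform, unfolded o_def]) auto
      show "(\<i> * of_real (b + 1)) islimpt (\<lambda>y. \<i> * complex_of_real y) ` {b<..}"
        by (rule islimpt_curve) (auto simp: complex_eq_iff simp del: of_real_add)
      show "\<i> * of_real (b + 1) \<in> V"
        by (rule ray) (simp add: b_def)
    qed (use V ray B that in \<open>auto simp: b_def\<close>)
    then show ?thesis using W(1) by auto
  qed
  then obtain \<nu> where distr: "\<And>n. real_distribution (\<nu> n)"
    and F\<nu>: "\<And>n z. z \<in> V \<Longrightarrow> F_transform (\<nu> n) (v n z) = z"
    by metis
  define g where "g n z = of_nat (n + 2) * (F_transform (\<nu> n) z - z)" for n z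
  define c where "c n z = (g n z - \<i>) / (g n z + \<i>)" for n z
  have g_im: "0 \<le> Im (g n z)" if "0 < Im z" for n z
    using real_distribution.Im_F_transform_ge[OF distr that, of n] unfolding g_def
    by (simp del: of_nat_add)
  have g_hol: "g n holomorphic_on upper_half_plane" for n
    unfolding g_def[abs_def] by (intro holomorphic_intros real_distribution.holomorphic_F_transform distr)
  have g_i: "g n z + \<i> \<noteq> 0" if "0 < Im z" for n z
    using g_im[OF that, of n] by (auto simp: complex_eq_iff)
  have c_norm: "cmod (c n z) \<le> 1" if "0 < Im z" for n z
  proof -
    have "(cmod (g n z - \<i>))\<^sup>2 \<le> (cmod (g n z + \<i>))\<^sup>2"
      using g_im[OF that, of n] unfolding cmod_power2 by (simp add: power2_eq_square algebra_simps)
    then have "cmod (g n z - \<i>) \<le> cmod (g n z + \<i>)"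
      by (rule power2_le_imp_le) simp
    then show ?thesis
      using g_i[OF that, of n] by (simp add: c_def norm_divide)
  qed
  have c_hol: "c n holomorphic_on upper_half_plane" for n
    unfolding c_def[abs_def] using g_i by (intro holomorphic_intros g_hol) auto
  obtain h r where h: "h holomorphic_on upper_half_plane" and r: "strict_mono (r :: nat \<Rightarrow> nat)"
    and lim: "\<And>z. z \<in> upper_half_plane \<Longrightarrow> (\<lambda>n. c (r n) z) \<longlonglongrightarrow> h z"
    and ulim: "\<And>K. compact K \<Longrightarrow> K \<subseteq> upper_half_plane \<Longrightarrow> uniform_limit K (c \<circ> r) h sequentially"
  proof (rule Montel[where \<F> = c and S = upper_half_plane and
        \<H> = "{f. f holomorphic_on upper_half_plane \<and> (\<forall>z\<in>upper_half_plane. cmod (f z) \<le> 1)}"])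
    show "\<exists>B. \<forall>h\<in>{f. f holomorphic_on upper_half_plane \<and> (\<forall>z\<in>upper_half_plane. cmod (f z) \<le> 1)}.
        \<forall>z\<in>K. cmod (h z) \<le> B" if "K \<subseteq> upper_half_plane" for K
      using that by (intro exI[of _ 1]) auto
  qed (use open_upper_half_plane c_hol c_norm in auto)
  have h_norm: "cmod (h z) \<le> 1" if "0 < Im z" for z
    using that c_norm by (intro LIMSEQ_le_const2[OF tendsto_norm[OF lim]]) auto
  have L_im: "0 \<le> Im (z - \<phi> z)" and h_eq: "h z = ((z - \<phi> z) - \<i>) / ((z - \<phi> z) + \<i>)" if z: "z \<in> V" for z
  proof -
    \<comment> \<open>The value does not depend on \<open>n\<close>, so the Cayley transforms
      \<open>c n\<close> are constant along the moving points \<open>v n z\<close>.\<close>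
    have gv: "g n (v n z) = z - \<phi> z" for n
    proof -
      have "q * (z - (z + (\<phi> z - z) / q)) = z - \<phi> z" if "q \<noteq> 0" for q
        using that by (simp add: field_simps)
      moreover have "(of_nat (n + 2) :: complex) \<noteq> 0"
        by (simp only: of_nat_eq_0_iff)
      ultimately have "of_nat (n + 2) * (z - v n z) = z - \<phi> z"
        unfolding v_def by blast
      then show ?thesis by (simp only: g_def F\<nu>[OF z])
    qed
    show "0 \<le> Im (z - \<phi> z)"
      using g_im[OF v[OF z], of 0 0] by (simp add: gv)
    have zH: "z \<in> upper_half_plane" using z V by auto
    obtain \<epsilon> where \<epsilon>: "0 < \<epsilon>" "cball z \<epsilon> \<subseteq> upper_half_plane"
      using open_upper_half_plane zH open_contains_cball by blast
    have "(\<lambda>n. z + (\<phi> z - z) * inverse (of_nat n)) \<longlonglongrightarrow> z + (\<phi> z - z) * 0"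
      by (intro tendsto_intros lim_inverse_n)
    from LIMSEQ_ignore_initial_segment[OF this, of 2] have "(\<lambda>n. v n z) \<longlonglongrightarrow> z"
      by (simp add: v_def divide_inverse)
    then have vr: "(\<lambda>n. v (r n) z) \<longlonglongrightarrow> z"
      using LIMSEQ_subseq_LIMSEQ[OF _ r, of "\<lambda>n. v n z"] by (simp add: o_def)
    have "isCont h z"
      using h zH holomorphic_on_imp_continuous_on[OF h]
      by (simp add: continuous_on_eq_continuous_at open_upper_half_plane)
    then have hv: "(\<lambda>n. h (v (r n) z)) \<longlonglongrightarrow> h z"
      using vr by (rule isCont_tendsto_compose)
    \<comment> \<open>The argument moves with \<open>n\<close>, hence uniform convergence on a
      closed disc around \<open>z\<close> is used.\<close>
    have "(\<lambda>n. dist (c (r n) (v (r n) z)) (h (v (r n) z))) \<longlonglongrightarrow> 0"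
    proof (rule tendstoI)
      fix e :: real assume "0 < e"
      then have "\<forall>\<^sub>F n in sequentially. \<forall>x\<in>cball z \<epsilon>. dist ((c \<circ> r) n x) (h x) < e"
        by (intro uniform_limitD ulim \<epsilon>) auto
      moreover have "\<forall>\<^sub>F n in sequentially. dist (v (r n) z) z < \<epsilon>"
        using tendstoD[OF vr \<epsilon>(1)] .
      ultimately show "\<forall>\<^sub>F n in sequentially. dist (dist (c (r n) (v (r n) z)) (h (v (r n) z))) 0 < e"
        by eventually_elim (auto simp: dist_commute)
    qed
    then have "(\<lambda>n. c (r n) (v (r n) z) - h (v (r n) z)) \<longlonglongrightarrow> 0"
      by (simp add: dist_norm tendsto_norm_zero_iff)
    from tendsto_add[OF this hv] have "(\<lambda>n. c (r n) (v (r n) z)) \<longlonglongrightarrow> h z" by simp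
    then show "h z = ((z - \<phi> z) - \<i>) / ((z - \<phi> z) + \<i>)"
      by (simp add: c_def gv LIMSEQ_const_iff)
  qed
  have L_i: "(z - \<phi> z) + \<i> \<noteq> 0" if "z \<in> V" for z
    using L_im[OF that] by (auto simp: complex_eq_iff)
  have "z0 \<in> V" using ray[of "\<beta> + 1"] by (simp add: z0_def)
  \<comment> \<open>The Cayley transform of a finite point is never 1. By the maximum modulus
    principle this one point excludes the value 1 throughout the half-plane, so the Cayley transform
    can be inverted.\<close>
  have "h z0 \<noteq> 1"
  proof
    assume "h z0 = 1"
    then have "(z0 - \<phi> z0) - \<i> = (z0 - \<phi> z0) + \<i>"
      using L_i[OF \<open>z0 \<in> V\<close>] unfolding h_eq[OF \<open>z0 \<in> V\<close>] by (simp only: divide_eq_1_iff)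
    then show False by (simp add: complex_eq_iff)
  qed
  have h_ne: "h z \<noteq> 1" if z: "0 < Im z" for z
  proof
    assume "h z = 1"
    then have "h constant_on upper_half_plane"
      using z h_norm
      by (intro maximum_modulus_principle[OF h open_upper_half_plane connected_upper_half_plane
            open_upper_half_plane order_refl, of z]) auto
    then have "h z0 = h z"
      using z \<open>z0 \<in> V\<close> V unfolding constant_on_def by auto
    then show False using \<open>h z0 \<noteq> 1\<close> \<open>h z = 1\<close> by simp
  qed
  show ?thesis
  proof
    show "(\<lambda>z. \<i> * (1 + h z) / (1 - h z)) holomorphic_on upper_half_plane"
      using h_ne by (intro holomorphic_intros h) force
    show "0 \<le> Im (\<i> * (1 + h z) / (1 - h z))" if "0 < Im z" for z
    proof -
      have "Im (\<i> * (1 + h z) / (1 - h z)) = (1 - (cmod (h z))\<^sup>2) / (cmod (1 - h z))\<^sup>2"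
        unfolding cmod_power2 by (simp add: Im_divide power2_eq_square algebra_simps)
      moreover have "(cmod (h z))\<^sup>2 \<le> 1"
        using h_norm[OF that] by (simp add: abs_square_le_1)
      ultimately show ?thesis by simp
    qed
    show "\<forall>\<^sub>F y in at_top. \<phi> (\<i> * of_real y) =
        \<i> * of_real y - \<i> * (1 + h (\<i> * of_real y)) / (1 - h (\<i> * of_real y))"
      using eventually_gt_at_top[of \<beta>]
    proof eventually_elim
      case (elim y)
      let ?z = "\<i> * complex_of_real y"
      define L where "L = ?z - \<phi> ?z"
      have L: "L + \<i> \<noteq> 0" "h ?z = (L - \<i>) / (L + \<i>)"
        using L_i[OF ray[OF elim]] h_eq[OF ray[OF elim]] by (simp_all add: L_def)
      have "1 + h ?z = 2 * L / (L + \<i>)" "1 - h ?z = 2 * \<i> / (L + \<i>)"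
        using L(1) unfolding L(2) by (simp_all add: field_simps)
      then have "\<i> * (1 + h ?z) / (1 - h ?z) = L"
        using L(1) by simp
      then show ?case by (simp add: L_def)
    qed
  qed
qed

section \<open>The subordination function\<close>

text \<open>Infinite divisibility of \<open>\<mu>2\<close> enters through \<open>N2\<close>, the map
  produced by \<open>voiculescu_transform_extension\<close>.\<close>

locale free_subordination =
  fixes \<mu>1 \<mu>2 \<mu> \<rho> :: "real measure" and U :: "complex set" and \<phi> \<phi>1 \<phi>2 N2 :: "complex \<Rightarrow> complex"
  assumes distr: "real_distribution \<mu>1" "real_distribution \<mu>2" "real_distribution \<rho>"
    and inv: "F_inverse_on \<mu> U \<phi>" "F_inverse_on \<mu>1 U \<phi>1" "F_inverse_on \<mu>2 U \<phi>2"
    and sum: "\<And>z. z \<in> U \<Longrightarrow> z + \<phi> z = \<phi>1 z + \<phi>2 z"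
    and N2: "N2 holomorphic_on upper_half_plane" "\<And>z. 0 < Im z \<Longrightarrow> 0 \<le> Im (N2 z)"
    and \<phi>2: "\<forall>\<^sub>F y in at_top. \<phi>2 (\<i> * of_real y) = \<i> * of_real y - N2 (\<i> * of_real y)"
    and subord: "\<And>z. 0 < Im z \<Longrightarrow> F_transform \<mu> z = F_transform \<mu>1 (F_transform \<rho> z)"
    and nondeg: "nondegenerate \<mu>2"
begin

definition N :: "complex \<Rightarrow> complex" where
  "N w = N2 (F_transform \<mu>1 w)"

lemma N_holomorphic: "N holomorphic_on upper_half_plane"
  unfolding N_def[abs_def]
  using real_distribution.Im_F_transform_pos[OF distr(1)]
  by (intro holomorphic_on_compose_gen[OF _ N2(1), unfolded o_def]
      real_distribution.holomorphic_F_transform distr) auto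

lemma Im_N_nonneg: "0 < Im z \<Longrightarrow> 0 \<le> Im (N z)"
  unfolding N_def by (intro N2 real_distribution.Im_F_transform_pos[OF distr(1)])

lemma Im_F_\<rho>: "0 < Im z \<Longrightarrow> 0 < Im (F_transform \<rho> z)"
  by (rule real_distribution.Im_F_transform_pos[OF distr(3)])

text \<open>The left-hand side is asymptotic to \<open>\<i> * of_real y\<close> and is sent to it by
  the F-transform of \<open>\<mu>1\<close>, so it lies on the branch \<open>\<phi>1\<close>.\<close>

lemma eventually_subordination:
  "\<forall>\<^sub>F y in at_top. F_transform \<rho> (\<phi> (\<i> * of_real y)) = \<phi>1 (\<i> * of_real y)"
proof (rule F_inverse_on_eventually_eq[OF distr(1) inv(2)])
  show "((\<lambda>y. F_transform \<rho> (\<phi> (\<i> * of_real y)) / (\<i> * of_real y)) \<longlongrightarrow> 1) at_top"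
    using inv(1) by (intro real_distribution.F_transform_asymptotics distr) (auto simp: F_inverse_on_def)
  show "\<forall>\<^sub>F y in at_top. F_transform \<mu>1 (F_transform \<rho> (\<phi> (\<i> * of_real y))) = \<i> * of_real y"
    using F_inverse_on_eventually_in[OF inv(1)]
  proof eventually_elim
    case (elim y)
    then show ?case using inv(1) subord[of "\<phi> (\<i> * of_real y)"] by (simp add: F_inverse_on_def)
  qed
qed

text \<open>At \<open>z = \<phi> (\<i> * of_real y)\<close> the subordination function takes the
  value \<open>\<phi>1 (\<i> * of_real y)\<close>, and the claim is the convolution equation. The
  identity theorem along this curve does the rest.\<close>

lemma subordination_inverse:
  assumes "0 < Im z"
  shows "F_transform \<rho> z - N (F_transform \<rho> z) = z"
proof -
  have "\<forall>\<^sub>F y in at_top. F_transform \<rho> (\<phi> (\<i> * of_real y)) - N (F_transform \<rho> (\<phi> (\<i> * of_real y))) = \<phi> (\<i> * of_real y)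
      \<and> \<i> * of_real y \<in> U"
    using eventually_subordination \<phi>2 F_inverse_on_eventually_in[OF inv(1)]
  proof eventually_elim
    case (elim y)
    have "F_transform \<mu>1 (\<phi>1 (\<i> * of_real y)) = \<i> * of_real y"
      using inv(2) elim(3) by (simp add: F_inverse_on_def)
    moreover have "\<phi>1 (\<i> * of_real y) - N2 (\<i> * of_real y) = \<phi> (\<i> * of_real y)"
      using sum[OF elim(3)] elim(2) by algebra
    ultimately show ?case using elim by (simp add: N_def)
  qed
  then obtain b where b: "\<And>y. y > b \<Longrightarrow> \<i> * of_real y \<in> U"
    "\<And>y. y > b \<Longrightarrow> F_transform \<rho> (\<phi> (\<i> * of_real y)) - N (F_transform \<rho> (\<phi> (\<i> * of_real y))) = \<phi> (\<i> * of_real y)"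
    by (auto simp: eventually_at_top_dense)
  have U: "open U" "\<phi> holomorphic_on U" "\<And>z. z \<in> U \<Longrightarrow> 0 < Im (\<phi> z)" "\<And>z. z \<in> U \<Longrightarrow> F_transform \<mu> (\<phi> z) = z"
    using inv(1) by (auto simp: F_inverse_on_def)
  have "F_transform \<rho> z - N (F_transform \<rho> z) - z = 0"
  proof (rule analytic_continuation[where f = "\<lambda>z. F_transform \<rho> z - N (F_transform \<rho> z) - z" and S = upper_half_plane
        and U = "(\<lambda>y. \<phi> (\<i> * of_real y)) ` {b<..}" and \<xi> = "\<phi> (\<i> * of_real (b + 1))"])
    show "(\<lambda>z. F_transform \<rho> z - N (F_transform \<rho> z) - z) holomorphic_on upper_half_plane"
      using Im_F_\<rho> by (intro holomorphic_intros holomorphic_on_compose_gen[OF _ N_holomorphic, unfolded o_def]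
          real_distribution.holomorphic_F_transform distr) auto
    show "\<phi> (\<i> * of_real (b + 1)) islimpt (\<lambda>y. \<phi> (\<i> * of_real y)) ` {b<..}"
    proof (rule islimpt_curve)
      have "isCont \<phi> (\<i> * of_real (b + 1))"
        using U(1,2) b(1)[of "b + 1"] holomorphic_on_imp_continuous_on[OF U(2)]
        by (simp add: continuous_on_eq_continuous_at)
      then show "isCont (\<lambda>y. \<phi> (\<i> * of_real y)) (b + 1)"
        by (rule isCont_o2[rotated]) (intro continuous_intros)
      \<comment> \<open>The curve does not return to its point at \<open>b + 1\<close>, because
        \<open>\<phi>\<close> has the F-transform of \<open>\<mu>\<close> as a left inverse.\<close>
      fix y assume y: "b < y" "\<phi> (\<i> * of_real y) = \<phi> (\<i> * of_real (b + 1))"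
      have "\<i> * complex_of_real y = F_transform \<mu> (\<phi> (\<i> * of_real y))"
        by (rule U(4)[OF b(1)[OF y(1)], symmetric])
      also have "\<dots> = \<i> * of_real (b + 1)"
        unfolding y(2) by (intro U(4) b(1)) simp
      finally show "y = b + 1"
        by (simp only: mult_cancel_left complex_i_not_zero of_real_eq_iff) simp
    qed simp
    show "\<phi> (\<i> * of_real (b + 1)) \<in> upper_half_plane"
      using U(3)[OF b(1)[of "b + 1"]] by simp
  qed (use open_upper_half_plane connected_upper_half_plane U(3) b assms in auto)
  then show ?thesis by simp
qed

section \<open>Strict positivity from nondegeneracy\<close>

text \<open>Otherwise \<open>N\<close> is affine; the asymptotics of the subordination function
  remove the linear term, and a constant \<open>N\<close> makes \<open>\<mu>2\<close> a point
  mass.\<close>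

lemma affine_defect_N_pos: "0 < affine_defect N"
proof -
  have "affine_defect N \<noteq> 0"
  proof
    assume D: "affine_defect N = 0"
    define \<alpha> \<beta> where "\<alpha> = Re (N \<i>)" and "\<beta> = Im (N \<i>)"
    have aff: "N w = of_real \<alpha> + of_real \<beta> * w" if "0 < Im w" for w
      using affine_if_affine_defect_eq_0[OF N_holomorphic Im_N_nonneg D that] by (simp add: \<alpha>_def \<beta>_def)
    have "((\<lambda>y. \<i> * complex_of_real y / (\<i> * of_real y)) \<longlongrightarrow> 1) at_top"
      by (rule Lim_transform_eventually[OF tendsto_const])
        (use eventually_gt_at_top[of 0] in \<open>eventually_elim, auto\<close>)
    then have "((\<lambda>y. F_transform \<rho> (\<i> * of_real y) / (\<i> * of_real y)) \<longlongrightarrow> 1) at_top"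
      by (rule real_distribution.F_transform_asymptotics[OF distr(3)])
    moreover have "((\<lambda>y. of_real \<alpha> / (\<i> * complex_of_real y)) \<longlongrightarrow> 0) at_top"
      by (intro tendsto_divide_0[OF tendsto_const]
          tendsto_mult_filterlim_at_infinity[OF tendsto_const] filterlim_of_real_at_infinity) auto
    \<comment> \<open>The equation of \<open>subordination_inverse\<close> divided by
      \<open>\<i> * of_real y\<close> says that this expression is 1 for \<open>y > 0\<close>;
      comparison with the limit gives \<open>\<beta> = 0\<close>.\<close>
    ultimately have "((\<lambda>y. (1 - of_real \<beta>) * (F_transform \<rho> (\<i> * of_real y) / (\<i> * of_real y)) - of_real \<alpha> / (\<i> * of_real y))
        \<longlongrightarrow> (1 - of_real \<beta>) * 1 - 0) at_top"
      by (intro tendsto_intros)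
    moreover have "\<forall>\<^sub>F y in at_top. (1 - of_real \<beta>) * (F_transform \<rho> (\<i> * of_real y) / (\<i> * of_real y))
        - of_real \<alpha> / (\<i> * of_real y) = 1"
      using eventually_gt_at_top[of 0]
    proof eventually_elim
      case (elim y)
      then have "(1 - of_real \<beta>) * F_transform \<rho> (\<i> * of_real y) - of_real \<alpha> = \<i> * of_real y"
        using subordination_inverse[of "\<i> * of_real y"] aff[OF Im_F_\<rho>] by (simp add: algebra_simps)
      moreover have "(1 - of_real \<beta>) * (F_transform \<rho> (\<i> * of_real y) / (\<i> * of_real y)) - of_real \<alpha> / (\<i> * of_real y)
          = ((1 - of_real \<beta>) * F_transform \<rho> (\<i> * of_real y) - of_real \<alpha>) / (\<i> * of_real y)"
        by (simp add: diff_divide_distrib)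
      ultimately show ?case using elim by simp
    qed
    ultimately have "((\<lambda>y::real. 1::complex) \<longlongrightarrow> (1 - of_real \<beta>) * 1 - 0) at_top"
      by (rule Lim_transform_eventually)
    then have "(1::complex) = (1 - of_real \<beta>) * 1 - 0"
      by (simp add: tendsto_const_iff)
    then have "\<beta> = 0" by simp
    have "\<forall>\<^sub>F y in at_top. 0 < y \<and> F_transform \<mu>2 (Complex (- \<alpha>) y) = \<i> * of_real y"
      using \<phi>2 F_inverse_on_eventually_in[OF inv(1)] eventually_gt_at_top[of 0]
    proof eventually_elim
      case (elim y)
      have "0 < Im (\<phi>1 (\<i> * of_real y))" "F_transform \<mu>1 (\<phi>1 (\<i> * of_real y)) = \<i> * of_real y"
        using inv(2) elim by (simp_all add: F_inverse_on_def)
      \<comment> \<open>Hence \<open>\<phi>2\<close> is translation by \<open>- \<alpha>\<close> at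
        these points, which determines the F-transform of \<open>\<mu>2\<close> there.\<close>
      then have "N2 (\<i> * of_real y) = of_real \<alpha>"
        using aff[of "\<phi>1 (\<i> * of_real y)"] \<open>\<beta> = 0\<close> by (simp add: N_def)
      moreover have "F_transform \<mu>2 (\<phi>2 (\<i> * of_real y)) = \<i> * of_real y"
        using inv(3) elim(2) by (simp add: F_inverse_on_def)
      moreover have "\<i> * of_real y - of_real \<alpha> = Complex (- \<alpha>) y"
        by (simp add: complex_eq_iff)
      ultimately show ?case using elim by simp
    qed
    then obtain y where y: "0 < y" "F_transform \<mu>2 (Complex (- \<alpha>) y) = \<i> * of_real y"
      using eventually_happens'[OF trivial_limit_at_top_linorder] by blast
    have "cauchy_transform \<mu>2 (Complex (- \<alpha>) y) = 1 / F_transform \<mu>2 (Complex (- \<alpha>) y)"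
      by (simp add: F_transform_def)
    then have "\<mu>2 = return borel (- \<alpha>)"
      unfolding y(2) by (rule real_distribution.eq_return_if_cauchy_transform[OF distr(2) y(1)])
    then show False using nondeg unfolding nondegenerate_def by blast
  qed
  then show ?thesis using affine_defect_nonneg[OF N_holomorphic Im_N_nonneg] by simp
qed

text \<open>If it vanished, the defect of \<open>N2\<close> would be both nonnegative and
  nonpositive, so \<open>N2\<close> and \<open>N\<close> would be real constants, contrary to
  \<open>affine_defect_N_pos\<close>.\<close>

lemma Im_N2_i_pos: "0 < Im (N2 \<i>)"
proof (rule ccontr)
  assume "\<not> ?thesis"
  then have 0: "Im (N2 \<i>) = 0" using N2(2)[of \<i>] by simp
  then have "affine_defect N2 = 0"
    using affine_defect_nonneg[OF N2] N2(2)[of "2 * \<i>"] by (simp add: affine_defect_def)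
  then have N2': "N2 w = of_real (Re (N2 \<i>))" if "0 < Im w" for w
    using affine_if_affine_defect_eq_0[OF N2 _ that] 0 by simp
  have "Im (N w) = 0" if "0 < Im w" for w
    unfolding N_def using N2'[OF real_distribution.Im_F_transform_pos[OF distr(1) that]]
    by (metis Im_complex_of_real)
  then show False using affine_defect_N_pos by (simp add: affine_defect_def)
qed

lemma Im_N_F_\<rho>_le: "0 < Im z \<Longrightarrow> Im (N (F_transform \<rho> z)) \<le> Im (F_transform \<rho> z)"
  using arg_cong[OF subordination_inverse, of z Im] by simp

section \<open>The Hoelder estimate and boundary values\<close>

text \<open>In \<open>schwarz_pick_defect\<close> the two ratios of imaginary parts are at most 1,
  and the difference quotient of \<open>N\<close> is 1 minus \<open>(z - z') / (w - w')\<close>.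
  Clearing the denominator \<open>cmod (w - w')\<close> produces the cube.\<close>

lemma F_\<rho>_cube_le:
  assumes z: "0 < Im z" and z': "0 < Im z'"
  defines "w \<equiv> F_transform \<rho> z" and "w' \<equiv> F_transform \<rho> z'"
  shows "affine_defect N / 6 * cmod (w - w') ^ 3 \<le> cmod (z - z') * ((1 + cmod w)\<^sup>2 * (1 + cmod w')\<^sup>2)"
proof (cases "w = w'")
  case False
  have w: "0 < Im w" "0 < Im w'" using z z' Im_F_\<rho> by (auto simp: w_def w'_def)
  have K: "0 < (1 + cmod w)\<^sup>2 * (1 + cmod w')\<^sup>2"
    by (intro mult_pos_pos zero_less_power add_pos_nonneg) auto
  have "Im (N w) / Im w \<le> 1" "Im (N w') / Im w' \<le> 1"
    using w Im_N_F_\<rho>_le[OF z] Im_N_F_\<rho>_le[OF z'] by (simp_all add: w_def w'_def)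
  moreover have "Re ((N w - N w') / (w - w')) = 1 - Re ((z - z') / (w - w'))"
  proof -
    have "N w - N w' = (w - w') - (z - z')"
      using subordination_inverse[OF z] subordination_inverse[OF z'] unfolding w_def w'_def
      by (metis (no_types, lifting) add_diff_cancel diff_add_cancel diff_diff_eq2 diff_diff_add add.commute)
    then show ?thesis using False by (simp add: diff_divide_distrib)
  qed
  moreover have "Re ((z - z') / (w - w')) \<le> cmod (z - z') / cmod (w - w')"
    by (metis complex_Re_le_cmod norm_divide)
  moreover have "affine_defect N / 6 * ((cmod (w - w'))\<^sup>2 / ((1 + cmod w)\<^sup>2 * (1 + cmod w')\<^sup>2)) \<le>
      (Im (N w) / Im w + Im (N w') / Im w') / 2 - Re ((N w - N w') / (w - w'))"
    by (rule schwarz_pick_defect[OF N_holomorphic _ w False]) (rule Im_N_nonneg)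
  moreover have "l \<le> t" if "a \<le> 1" "b \<le> 1" "q = 1 - r" "r \<le> t" "l \<le> (a + b) / 2 - q" for a b q r t l :: real
    using that by argo
  ultimately have "affine_defect N / 6 * ((cmod (w - w'))\<^sup>2 / ((1 + cmod w)\<^sup>2 * (1 + cmod w')\<^sup>2)) \<le>
      cmod (z - z') / cmod (w - w')"
    by blast
  then have "affine_defect N / 6 * (cmod (w - w'))\<^sup>2 * cmod (w - w') \<le> cmod (z - z') * ((1 + cmod w)\<^sup>2 * (1 + cmod w')\<^sup>2)"
    using K False by (simp add: divide_simps mult_ac)
  then show ?thesis by (simp add: power3_eq_cube power2_eq_square mult_ac)
qed auto

text \<open>Comparison with the value at \<open>\<i>\<close>: in \<open>F_\<rho>_cube_le\<close> the
  left side is cubic in the distance \<open>d\<close>, while the weights on the right grow only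
  quadratically.\<close>

lemma F_\<rho>_bounded:
  obtains B where "\<And>z. 0 < Im z \<Longrightarrow> cmod z \<le> R \<Longrightarrow> cmod (F_transform \<rho> z) \<le> B"
proof -
  define c where "c = affine_defect N / 6"
  have c: "0 < c" using affine_defect_N_pos by (simp add: c_def)
  define A where "A = 1 + cmod (F_transform \<rho> \<i>)"
  have A: "1 \<le> A" by (simp add: A_def)
  have "cmod (F_transform \<rho> z) \<le> A + max A ((\<bar>R\<bar> + 1) * (4 * A\<^sup>2) / c)" if z: "0 < Im z" "cmod z \<le> R" for z
  proof -
    define d where "d = cmod (F_transform \<rho> z - F_transform \<rho> \<i>)"
    have le: "cmod (F_transform \<rho> z) \<le> cmod (F_transform \<rho> \<i>) + d"
      using norm_triangle_sub by (simp add: d_def)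
    have "d \<le> max A ((\<bar>R\<bar> + 1) * (4 * A\<^sup>2) / c)"
    proof (cases "d \<le> A")
      case False
      then have d: "0 < d" using A by simp
      have "c * d ^ 3 \<le> cmod (z - \<i>) * ((1 + cmod (F_transform \<rho> z))\<^sup>2 * A\<^sup>2)"
        using F_\<rho>_cube_le[of z \<i>] z by (simp add: d_def c_def A_def)
      also have "\<dots> \<le> (\<bar>R\<bar> + 1) * ((2 * d)\<^sup>2 * A\<^sup>2)"
      proof (intro mult_mono power_mono order_refl)
        show "cmod (z - \<i>) \<le> \<bar>R\<bar> + 1"
          using norm_triangle_ineq4[of z \<i>] z(2) by simp
        show "1 + cmod (F_transform \<rho> z) \<le> 2 * d"
          using le False by (simp add: A_def)
      qed (use A in auto)
      finally have "d\<^sup>2 * (c * d) \<le> d\<^sup>2 * ((\<bar>R\<bar> + 1) * (4 * A\<^sup>2))"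
        by (simp add: power2_eq_square power3_eq_cube mult_ac)
      then have "c * d \<le> (\<bar>R\<bar> + 1) * (4 * A\<^sup>2)"
        using d by (simp add: mult_le_cancel_left)
      then have "d \<le> (\<bar>R\<bar> + 1) * (4 * A\<^sup>2) / c"
        using c by (simp add: pos_le_divide_eq mult.commute)
      then show ?thesis by simp
    qed simp
    then show ?thesis using le by (simp add: A_def)
  qed
  then show ?thesis by (rule that)
qed

lemma F_\<rho>_holder:
  obtains K where "0 < K" "\<And>z z'. 0 < Im z \<Longrightarrow> 0 < Im z' \<Longrightarrow> cmod z \<le> R \<Longrightarrow> cmod z' \<le> R \<Longrightarrow>
    cmod (F_transform \<rho> z - F_transform \<rho> z') ^ 3 \<le> K * cmod (z - z')"
proof -
  obtain B where B: "\<And>z. 0 < Im z \<Longrightarrow> cmod z \<le> R \<Longrightarrow> cmod (F_transform \<rho> z) \<le> B"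
    using F_\<rho>_bounded by blast
  define c where "c = affine_defect N / 6"
  have c: "0 < c" using affine_defect_N_pos by (simp add: c_def)
  show ?thesis
  proof
    show "0 < (1 + \<bar>B\<bar>)\<^sup>2 * (1 + \<bar>B\<bar>)\<^sup>2 / c"
      using c by (intro divide_pos_pos mult_pos_pos zero_less_power) auto
    fix z z' assume z: "0 < Im z" "0 < Im z'" "cmod z \<le> R" "cmod z' \<le> R"
    have "c * cmod (F_transform \<rho> z - F_transform \<rho> z') ^ 3 \<le>
        cmod (z - z') * ((1 + cmod (F_transform \<rho> z))\<^sup>2 * (1 + cmod (F_transform \<rho> z'))\<^sup>2)"
      using F_\<rho>_cube_le[OF z(1,2)] by (simp add: c_def)
    also have "\<dots> \<le> cmod (z - z') * ((1 + \<bar>B\<bar>)\<^sup>2 * (1 + \<bar>B\<bar>)\<^sup>2)"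
      using B[OF z(1,3)] B[OF z(2,4)] by (intro mult_left_mono mult_mono power_mono) auto
    finally show "cmod (F_transform \<rho> z - F_transform \<rho> z') ^ 3 \<le> (1 + \<bar>B\<bar>)\<^sup>2 * (1 + \<bar>B\<bar>)\<^sup>2 / c * cmod (z - z')"
      using c by (simp add: field_simps)
  qed
qed

text \<open>The Hoelder estimate gives uniform continuity on a half-disc, hence a limit at its
  boundary point; the \<open>Lim\<close> in \<open>F_boundary\<close> is therefore genuine.\<close>

lemma tendsto_F_boundary:
  "(F_transform \<rho> \<longlongrightarrow> F_boundary \<rho> x) (at (of_real x) within upper_half_plane)"
proof -
  define S where "S = upper_half_plane \<inter> ball (complex_of_real x) 1"
  obtain K where K: "0 < K" "\<And>z z'. 0 < Im z \<Longrightarrow> 0 < Im z' \<Longrightarrow> cmod z \<le> \<bar>x\<bar> + 1 \<Longrightarrow> cmod z' \<le> \<bar>x\<bar> + 1 \<Longrightarrow>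
    cmod (F_transform \<rho> z - F_transform \<rho> z') ^ 3 \<le> K * cmod (z - z')"
    using F_\<rho>_holder by blast
  have S: "cmod z \<le> \<bar>x\<bar> + 1" "0 < Im z" if "z \<in> S" for z
    using that norm_triangle_sub[of z "of_real x"] by (auto simp: S_def dist_norm norm_minus_commute)
  have "uniformly_continuous_on S (F_transform \<rho>)"
    unfolding uniformly_continuous_on_def
  proof (intro allI impI)
    fix e :: real assume e: "0 < e"
    show "\<exists>d>0. \<forall>z\<in>S. \<forall>z'\<in>S. dist z' z < d \<longrightarrow> dist (F_transform \<rho> z') (F_transform \<rho> z) < e"
    proof (intro exI[of _ "e ^ 3 / K"] conjI ballI impI)
      show "0 < e ^ 3 / K" using e K by simp
      fix z z' assume "z \<in> S" "z' \<in> S" and d: "dist z' z < e ^ 3 / K"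
      then have "cmod (F_transform \<rho> z' - F_transform \<rho> z) ^ 3 \<le> K * cmod (z' - z)"
        by (intro K(2) S)
      also have "\<dots> < e ^ 3"
        using d K(1) by (simp add: dist_norm field_simps)
      finally show "dist (F_transform \<rho> z') (F_transform \<rho> z) < e"
        using e by (simp add: dist_norm power_less_imp_less_base)
    qed
  qed
  moreover have seq: "(\<lambda>n. Complex x (1 / real (Suc n))) \<longlonglongrightarrow> of_real x"
    using tendsto_Complex[OF tendsto_const LIMSEQ_inverse_real_of_nat]
    by (simp add: complex_of_real_def inverse_eq_divide)
  have limpt: "of_real x islimpt upper_half_plane"
    unfolding islimpt_sequential
    by (intro exI[of _ "\<lambda>n. Complex x (1 / real (Suc n))"] conjI allI seq) (auto simp: complex_eq_iff)
  then have "of_real x islimpt S"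
    unfolding S_def by (intro islimpt_Int_eventually eventually_at_in_open') auto
  then have "of_real x \<in> closure S"
    by (simp add: closure_def)
  ultimately obtain l where "(F_transform \<rho> \<longlongrightarrow> l) (at (of_real x) within S)"
    using uniformly_continuous_on_extension_at_closure by blast
  then have l: "(F_transform \<rho> \<longlongrightarrow> l) (at (of_real x) within upper_half_plane)"
    using at_within_nhd[of "of_real x" "ball (of_real x) 1" S upper_half_plane] by (simp add: S_def Int_assoc)
  moreover have "F_boundary \<rho> x = l"
    unfolding F_boundary_def using l limpt by (intro tendsto_Lim) (simp add: trivial_limit_within)
  ultimately show ?thesis by simp
qed

lemma tendsto_F_boundary_sequentially:
  "(\<lambda>n. F_transform \<rho> (Complex x (1 / real (Suc n)))) \<longlonglongrightarrow> F_boundary \<rho> x"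
proof -
  define X where "X n = Complex x (1 / real (Suc n))" for n
  have "X \<longlonglongrightarrow> of_real x"
    using tendsto_Complex[OF tendsto_const LIMSEQ_inverse_real_of_nat]
    by (simp add: X_def[abs_def] complex_of_real_def inverse_eq_divide)
  moreover have "\<forall>n. X n \<in> upper_half_plane - {of_real x}"
    by (auto simp: X_def complex_eq_iff)
  ultimately have "(\<lambda>n. F_transform \<rho> (X n)) \<longlonglongrightarrow> F_boundary \<rho> x"
    using tendsto_F_boundary[of x] unfolding tendsto_at_iff_sequentially o_def by blast
  then show ?thesis by (simp add: X_def)
qed

lemma F_boundary_holder:
  obtains K where "0 < K" "\<And>x. \<bar>x - x0\<bar> \<le> 1 \<Longrightarrow> cmod (F_boundary \<rho> x - F_boundary \<rho> x0) ^ 3 \<le> K * \<bar>x - x0\<bar>"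
proof -
  \<comment> \<open>The radius allows distance 1 from \<open>x0\<close> along the line and height at
    most 1.\<close>
  obtain K where K: "0 < K" "\<And>z z'. 0 < Im z \<Longrightarrow> 0 < Im z' \<Longrightarrow> cmod z \<le> \<bar>x0\<bar> + 2 \<Longrightarrow> cmod z' \<le> \<bar>x0\<bar> + 2 \<Longrightarrow>
    cmod (F_transform \<rho> z - F_transform \<rho> z') ^ 3 \<le> K * cmod (z - z')"
    using F_\<rho>_holder by blast
  show ?thesis
  proof
    fix x assume x: "\<bar>x - x0\<bar> \<le> 1"
    have "(\<lambda>n. cmod (F_transform \<rho> (Complex x (1 / real (Suc n))) - F_transform \<rho> (Complex x0 (1 / real (Suc n)))) ^ 3)
        \<longlonglongrightarrow> cmod (F_boundary \<rho> x - F_boundary \<rho> x0) ^ 3"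
      by (intro tendsto_intros tendsto_F_boundary_sequentially)
    moreover have "cmod (F_transform \<rho> (Complex x (1 / real (Suc n))) - F_transform \<rho> (Complex x0 (1 / real (Suc n)))) ^ 3
        \<le> K * \<bar>x - x0\<bar>" for n
    proof -
      have le: "cmod (Complex t (1 / real (Suc n))) \<le> \<bar>t\<bar> + 1" for t
        using cmod_le[of "Complex t (1 / real (Suc n))"] by (simp add: order_trans[OF _ add_left_mono])
      have "cmod (F_transform \<rho> (Complex x (1 / real (Suc n))) - F_transform \<rho> (Complex x0 (1 / real (Suc n)))) ^ 3
        \<le> K * cmod (Complex x (1 / real (Suc n)) - Complex x0 (1 / real (Suc n)))"
        using le[of x] le[of x0] x by (intro K(2)) (simp, simp, linarith, linarith)
      \<comment> \<open>Approaching both points at equal heights makes the difference real and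
        independent of \<open>n\<close>.\<close>
      also have "Complex x (1 / real (Suc n)) - Complex x0 (1 / real (Suc n)) = of_real (x - x0)"
        by (simp add: complex_eq_iff)
      finally show ?thesis by (simp del: of_real_diff)
    qed
    ultimately show "cmod (F_boundary \<rho> x - F_boundary \<rho> x0) ^ 3 \<le> K * \<bar>x - x0\<bar>"
      by (intro LIMSEQ_le_const2) auto
  qed (rule K)
qed

lemma Im_N_F_boundary_le:
  assumes "0 < Im (F_boundary \<rho> x)"
  shows "Im (N (F_boundary \<rho> x)) \<le> Im (F_boundary \<rho> x)"
proof -
  have "isCont N (F_boundary \<rho> x)"
    using assms holomorphic_on_imp_continuous_on[OF N_holomorphic]
    by (simp add: continuous_on_eq_continuous_at open_upper_half_plane)
  then have "(\<lambda>n. N (F_transform \<rho> (Complex x (1 / real (Suc n))))) \<longlonglongrightarrow> N (F_boundary \<rho> x)"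
    using tendsto_F_boundary_sequentially by (rule isCont_tendsto_compose)
  from tendsto_Im[OF this] tendsto_Im[OF tendsto_F_boundary_sequentially] show ?thesis
    by (rule LIMSEQ_le) (auto intro!: exI[of _ 0] Im_N_F_\<rho>_le)
qed

text \<open>The ratio \<open>Im (N w) / Im w\<close> is at most 1 along a sequence in the range of
  the subordination function tending to \<open>u\<close>, and \<open>Im_quotient_le\<close> carries
  this bound to the vertical line.\<close>

lemma Im_N_above_real_F_boundary:
  assumes "F_boundary \<rho> x = of_real u" "0 < y"
  shows "Im (N (Complex u y)) \<le> y"
proof -
  define w where "w n = F_transform \<rho> (Complex x (1 / real (Suc n)))" for n
  have w: "w \<longlonglongrightarrow> of_real u"
    using tendsto_F_boundary_sequentially[of x] by (simp add: w_def[abs_def] assms(1))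
  have "Im (N (Complex u y)) / y \<le> (1 + cmod (w n - of_real u) / y)\<^sup>2" for n
  proof -
    have pos: "0 < Im (w n)" "Im (N (w n)) \<le> Im (w n)"
      unfolding w_def by (intro Im_F_\<rho> Im_N_F_\<rho>_le; simp)+
    have "Im (N (Complex u y)) / y \<le> (1 + cmod (w n - of_real u) / y)\<^sup>2 * (Im (N (w n)) / Im (w n))"
      by (rule Im_quotient_le[OF N_holomorphic _ pos(1) assms(2)]) (rule Im_N_nonneg)
    also have "\<dots> \<le> (1 + cmod (w n - of_real u) / y)\<^sup>2 * 1"
      using pos by (intro mult_left_mono) auto
    finally show ?thesis by simp
  qed
  moreover have "(\<lambda>n. (1 + cmod (w n - of_real u) / y)\<^sup>2) \<longlonglongrightarrow> (1 + cmod (of_real u - complex_of_real u) / y)\<^sup>2"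
    using assms(2) by (intro tendsto_intros w) auto
  ultimately have "Im (N (Complex u y)) / y \<le> (1 + cmod (of_real u - complex_of_real u) / y)\<^sup>2"
    by (intro LIMSEQ_le_const) auto
  then show ?thesis using assms(2) by (simp add: divide_le_eq)
qed

section \<open>The Cauchy transform of \<open>\<mu>1\<close> near the boundary value\<close>

text \<open>Harnack's inequality for \<open>N2\<close> at the point \<open>F\<close> bounds
  \<open>Im (N w)\<close> below by a multiple of \<open>Im F / (1 + cmod F)\<^sup>2\<close>, which
  in terms of \<open>G = 1 / F\<close> is \<open>Im w * E / (1 + cmod G)\<^sup>2\<close>. The square
  on the right suits \<open>cauchy_transform_diff_le\<close>.\<close>

lemma cauchy_energy_\<mu>1_le:
  assumes w: "0 < Im w" and le: "Im (N w) \<le> Im w"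
  shows "cauchy_energy \<mu>1 w \<le> ((1 + cmod (cauchy_transform \<mu>1 w)) / sqrt (Im (N2 \<i>)))\<^sup>2"
proof -
  interpret real_distribution \<mu>1 by (rule distr)
  define k G F E where "k = Im (N2 \<i>)" and "G = cauchy_transform \<mu>1 w" and "F = F_transform \<mu>1 w"
    and "E = cauchy_energy \<mu>1 w"
  have k: "0 < k" using Im_N2_i_pos by (simp add: k_def)
  have G: "0 < cmod G" using cauchy_transform_nonzero[OF w] by (simp add: G_def)
  have "Im F = Im w * E / (cmod G)\<^sup>2"
    using Im_cauchy_transform[OF w]
    by (simp add: F_def F_transform_def G_def E_def Im_divide cmod_power2)
  moreover have "1 + cmod F = (1 + cmod G) / cmod G"
    using G by (simp add: F_def F_transform_def G_def norm_divide field_simps)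
  ultimately have "Im F / (1 + cmod F)\<^sup>2 = Im w * E / (1 + cmod G)\<^sup>2"
    using G by (simp add: power_divide)
  moreover have "k * (Im F / (1 + cmod F)\<^sup>2) \<le> Im (N w)"
    unfolding k_def F_def N_def by (rule Im_ge_of_Im_at_i[OF N2 Im_F_transform_pos[OF w]])
  ultimately have "k * (Im w * E / (1 + cmod G)\<^sup>2) \<le> Im w"
    using le by simp
  then have "Im w * (k * E / (1 + cmod G)\<^sup>2) \<le> Im w * 1"
    by (simp add: mult_ac)
  then have "k * E / (1 + cmod G)\<^sup>2 \<le> 1"
    using w by (simp only: mult_le_cancel_left_pos)
  moreover have "0 < (1 + cmod G)\<^sup>2" by (intro zero_less_power add_pos_nonneg) auto
  ultimately have "E \<le> (1 + cmod G)\<^sup>2 / k"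
    using k by (simp add: field_simps)
  then show ?thesis
    using k by (simp add: E_def G_def k_def power_divide)
qed

text \<open>\<open>cauchy_transform_diff_le\<close> contributes the factor \<open>a * b\<close>,
  exactly the denominator of \<open>1 / a - 1 / b\<close>. Only the two endpoints have to satisfy
  the constraint, so no path between them is involved.\<close>

lemma inverse_cauchy_transform_lipschitz:
  assumes v: "0 < Im v" "Im (N v) \<le> Im v" and w: "0 < Im w" "Im (N w) \<le> Im w"
  shows "1 / (1 + cmod (cauchy_transform \<mu>1 v)) - 1 / (1 + cmod (cauchy_transform \<mu>1 w)) \<le> cmod (v - w) / Im (N2 \<i>)"
proof -
  define k where "k = Im (N2 \<i>)"
  have k: "0 < k" using Im_N2_i_pos by (simp add: k_def)
  define a b where "a = 1 + cmod (cauchy_transform \<mu>1 v)" and "b = 1 + cmod (cauchy_transform \<mu>1 w)"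
  have pos: "0 < a" "0 < b" by (auto simp: a_def b_def intro: add_pos_nonneg)
  have "cmod (cauchy_transform \<mu>1 v - cauchy_transform \<mu>1 w) \<le> cmod (v - w) * (a / sqrt k * (b / sqrt k))"
    using cauchy_energy_\<mu>1_le[OF v] cauchy_energy_\<mu>1_le[OF w] pos k unfolding a_def b_def k_def
    by (intro real_distribution.cauchy_transform_diff_le[OF distr(1)] v w divide_pos_pos) auto
  also have "\<dots> = cmod (v - w) * (a * b) / k"
    using k by simp
  finally have "b - a \<le> cmod (v - w) * (a * b) / k"
    using norm_triangle_ineq3[of "cauchy_transform \<mu>1 v" "cauchy_transform \<mu>1 w"] by (simp add: a_def b_def)
  moreover have "1 / a - 1 / b = (b - a) / (a * b)"
    using pos by (simp add: field_simps)
  ultimately have "1 / a - 1 / b \<le> cmod (v - w) * (a * b) / k / (a * b)"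
    using pos by (simp only: divide_right_mono mult_nonneg_nonneg less_imp_le)
  then show ?thesis using pos by (simp add: a_def b_def k_def)
qed

text \<open>In the absence of an atom, some point \<open>q\<close> above \<open>u\<close> has small
  \<open>Im q * m q\<close>. The Lipschitz estimate from \<open>q\<close> then keeps
  \<open>1 / m w\<close> away from 0 in a disc of radius \<open>Im q\<close>.\<close>

lemma cauchy_transform_\<mu>1_bounded_near:
  assumes "F_boundary \<rho> x = of_real u" "measure \<mu>1 {u} = 0"
  obtains r B where "0 < r" "\<And>w. 0 < Im w \<Longrightarrow> Im (N w) \<le> Im w \<Longrightarrow> cmod (w - of_real u) < r \<Longrightarrow>
    1 + cmod (cauchy_transform \<mu>1 w) \<le> B"
proof -
  define k where "k = Im (N2 \<i>)"
  have k: "0 < k" using Im_N2_i_pos by (simp add: k_def)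
  define m where "m w = 1 + cmod (cauchy_transform \<mu>1 w)" for w
  have m: "0 < m w" for w by (auto simp: m_def intro: add_pos_nonneg)
  define y where "y n = 1 / real (Suc n)" for n
  have y: "y \<longlonglongrightarrow> 0" "0 < y n" for n
    using LIMSEQ_inverse_real_of_nat by (auto simp: y_def[abs_def] inverse_eq_divide)
  have "(\<lambda>n. y n + cmod (of_real (y n) * cauchy_transform \<mu>1 (Complex u (y n)))) \<longlonglongrightarrow> 0 + cmod 0"
    unfolding y_def
    by (intro tendsto_add tendsto_norm real_distribution.cauchy_transform_no_atom distr assms)
      (use y(1) in \<open>simp add: y_def[abs_def]\<close>)
  then have "(\<lambda>n. y n * m (Complex u (y n))) \<longlonglongrightarrow> 0"
    using y(2) by (simp add: m_def norm_mult distrib_left less_imp_le abs_of_pos)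
  then have "\<forall>\<^sub>F n in sequentially. y n * m (Complex u (y n)) < k / 4"
    using k by (intro order_tendstoD) auto
  then obtain n where n: "y n * m (Complex u (y n)) < k / 4"
    using eventually_happens'[OF sequentially_bot] by blast
  define q where "q = Complex u (y n)"
  have q: "0 < Im q" "Im (N q) \<le> Im q"
    using y(2)[of n] Im_N_above_real_F_boundary[OF assms(1) y(2)[of n]] by (simp_all add: q_def)
  \<comment> \<open>Points of the disc are within \<open>2 * y n\<close> of \<open>q\<close>, so the
    Lipschitz estimate costs \<open>2 * y n / k\<close> and leaves as much; hence the threshold
    \<open>k / 4\<close>.\<close>
  have inv_q: "4 * y n / k < 1 / m q"
    using n k m[of q] by (simp add: q_def field_simps)
  show ?thesis
  proof
    show "0 < y n" by (rule y)
    fix w assume w: "0 < Im w" "Im (N w) \<le> Im w" "cmod (w - of_real u) < y n"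
    have "cmod (q - of_real u) = y n"
      using y(2)[of n] by (simp add: q_def cmod_def)
    then have "cmod (q - w) \<le> 2 * y n"
      using w(3) norm_triangle_ineq4[of "q - of_real u" "w - of_real u"] by simp
    then have "cmod (q - w) / k \<le> 2 * y n / k"
      using k by (intro divide_right_mono) auto
    then have "2 * y n / k \<le> 1 / m w"
      using inverse_cauchy_transform_lipschitz[OF q w(1,2)] inv_q unfolding m_def k_def by argo
    then show "1 + cmod (cauchy_transform \<mu>1 w) \<le> k / (2 * y n)"
      using m[of w] k y(2)[of n] unfolding m_def[symmetric] by (simp add: field_simps)
  qed
qed

text \<open>The imaginary part is \<open>Im w\<close> times the energy. The energy is bounded near
  \<open>u\<close>, and \<open>Im w\<close> is at most the distance to \<open>u\<close>, which the
  Hoelder estimate controls by the cube root.\<close>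

lemma density_bound:
  assumes "F_boundary \<rho> x0 = of_real u" "measure \<mu>1 {u} = 0"
  obtains \<delta> C where "0 < \<delta>" "\<And>x. \<bar>x - x0\<bar> < \<delta> \<Longrightarrow> 0 < Im (F_boundary \<rho> x) \<Longrightarrow>
    \<bar>Im (cauchy_transform \<mu>1 (F_boundary \<rho> x))\<bar> \<le> C * \<bar>x - x0\<bar> powr (1 / 3)"
proof -
  define k where "k = Im (N2 \<i>)"
  have k: "0 < k" using Im_N2_i_pos by (simp add: k_def)
  obtain r B where r: "0 < r" and B: "\<And>w. 0 < Im w \<Longrightarrow> Im (N w) \<le> Im w \<Longrightarrow> cmod (w - of_real u) < r \<Longrightarrow>
    1 + cmod (cauchy_transform \<mu>1 w) \<le> B"
    using cauchy_transform_\<mu>1_bounded_near[OF assms] by blast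
  obtain K where K: "0 < K" "\<And>x. \<bar>x - x0\<bar> \<le> 1 \<Longrightarrow> cmod (F_boundary \<rho> x - F_boundary \<rho> x0) ^ 3 \<le> K * \<bar>x - x0\<bar>"
    using F_boundary_holder by blast
  show ?thesis
  proof
    show "0 < min 1 (r ^ 3 / K)" using r K by simp
    fix x assume x: "\<bar>x - x0\<bar> < min 1 (r ^ 3 / K)" and pos: "0 < Im (F_boundary \<rho> x)"
    define w where "w = F_boundary \<rho> x"
    have cube: "cmod (w - of_real u) ^ 3 \<le> K * \<bar>x - x0\<bar>"
      using K(2)[of x] x by (simp add: w_def assms(1))
    also have "\<dots> < r ^ 3"
      using x K(1) by (simp add: field_simps)
    finally have near: "cmod (w - of_real u) < r"
      by (rule power_less_imp_less_base) (use r in simp)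
    have w: "0 < Im w" "Im (N w) \<le> Im w"
      using pos Im_N_F_boundary_le by (simp_all add: w_def)
    have "cauchy_energy \<mu>1 w \<le> ((1 + cmod (cauchy_transform \<mu>1 w)) / sqrt k)\<^sup>2"
      unfolding k_def by (rule cauchy_energy_\<mu>1_le[OF w])
    also have "\<dots> \<le> (B / sqrt k)\<^sup>2"
      using B[OF w near] k by (intro power_mono divide_right_mono) auto
    also have "\<dots> = B\<^sup>2 / k" using k by (simp add: power_divide)
    finally have E: "cauchy_energy \<mu>1 w \<le> B\<^sup>2 / k" .
    have "Im w \<le> cmod (w - of_real u)"
      by (rule Im_le_cmod_diff_real)
    also have "\<dots> = (cmod (w - of_real u) ^ 3) powr (1 / 3)"
    proof -
      have "0 < cmod (w - of_real u)" using w by (auto simp: complex_eq_iff)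
      then show ?thesis by (simp add: powr_powr flip: powr_numeral)
    qed
    also have "\<dots> \<le> (K * \<bar>x - x0\<bar>) powr (1 / 3)"
      using cube by (intro powr_mono2) auto
    also have "\<dots> = K powr (1 / 3) * \<bar>x - x0\<bar> powr (1 / 3)"
      using K by (simp add: powr_mult)
    finally have "Im w * cauchy_energy \<mu>1 w \<le> K powr (1 / 3) * \<bar>x - x0\<bar> powr (1 / 3) * (B\<^sup>2 / k)"
      using E w real_distribution.cauchy_energy_pos[OF distr(1) w(1)] by (intro mult_mono) auto
    then show "\<bar>Im (cauchy_transform \<mu>1 (F_boundary \<rho> x))\<bar> \<le> K powr (1 / 3) * (B\<^sup>2 / k) * \<bar>x - x0\<bar> powr (1 / 3)"
      using real_distribution.Im_cauchy_transform[OF distr(1) w(1)] w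
        real_distribution.cauchy_energy_pos[OF distr(1) w(1)]
      by (simp add: w_def[symmetric] abs_mult mult_ac)
  qed
qed

end

theorem theorem9p4:
  fixes \<mu>1 \<mu>2 \<mu> \<rho>1 :: "real measure" and I :: "real set" and x0 :: real and p :: "real \<Rightarrow> real"
  assumes "real_distribution \<mu>1" and "real_distribution \<mu>2"
    and "nondegenerate \<mu>1" and "nondegenerate \<mu>2"
    and "freely_infinitely_divisible \<mu>2"
    and "is_free_convolution \<mu>1 \<mu>2 \<mu>"
    and "real_distribution \<rho>1"
    and "\<forall>z\<in>upper_half_plane. F_transform \<mu> z = F_transform \<mu>1 (F_transform \<rho>1 z)"
    and "open I" and "is_interval I" and "x0 \<in> frontier I"
    and "\<forall>x\<in>I. F_boundary \<rho>1 x \<in> upper_half_plane"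
    and "F_boundary \<rho>1 x0 \<in> \<real>" and "measure \<mu>1 {Re (F_boundary \<rho>1 x0)} = 0"
    and "lebesgue_density_on \<mu> I p"
    and "\<forall>x\<in>I. p x = - (1 / pi) * Im (cauchy_transform \<mu>1 (F_boundary \<rho>1 x))"
  shows "\<exists>\<delta>>0. bounded ((\<lambda>x. p x / \<bar>x - x0\<bar> powr (1 / 3)) ` (I \<inter> ball x0 \<delta>))"
proof -
  obtain U \<phi> \<phi>1 \<phi>2 where inv: "F_inverse_on \<mu> U \<phi>" "F_inverse_on \<mu>1 U \<phi>1" "F_inverse_on \<mu>2 U \<phi>2"
    and sum: "\<forall>z\<in>U. z + \<phi> z = \<phi>1 z + \<phi>2 z"
    using assms(6) unfolding is_free_convolution_def by blast
  obtain N2 where N2: "N2 holomorphic_on upper_half_plane" "\<And>z. 0 < Im z \<Longrightarrow> 0 \<le> Im (N2 z)"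
    "\<forall>\<^sub>F y in at_top. \<phi>2 (\<i> * of_real y) = \<i> * of_real y - N2 (\<i> * of_real y)"
    using voiculescu_transform_extension[OF assms(5) inv(3)] by blast
  interpret free_subordination \<mu>1 \<mu>2 \<mu> \<rho>1 U \<phi> \<phi>1 \<phi>2 N2
    by (rule free_subordination.intro)
      (fact assms inv N2 sum[rule_format] | (rule assms(8)[rule_format], simp))+
  obtain u where u: "F_boundary \<rho>1 x0 = of_real u"
    using assms(13) by (auto elim: Reals_cases)
  obtain \<delta> C where \<delta>: "0 < \<delta>" and C: "\<And>x. \<bar>x - x0\<bar> < \<delta> \<Longrightarrow> 0 < Im (F_boundary \<rho>1 x) \<Longrightarrow>
    \<bar>Im (cauchy_transform \<mu>1 (F_boundary \<rho>1 x))\<bar> \<le> C * \<bar>x - x0\<bar> powr (1 / 3)"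
    using density_bound[OF u] assms(14) by (auto simp: u)
  show ?thesis
  proof (intro exI[of _ \<delta>] conjI \<delta> boundedI)
    fix a assume "a \<in> (\<lambda>x. p x / \<bar>x - x0\<bar> powr (1 / 3)) ` (I \<inter> ball x0 \<delta>)"
    then obtain x where x: "x \<in> I" "\<bar>x - x0\<bar> < \<delta>" "a = p x / \<bar>x - x0\<bar> powr (1 / 3)"
      by (auto simp: dist_real_def abs_minus_commute)
    have "\<bar>p x\<bar> = 1 / pi * \<bar>Im (cauchy_transform \<mu>1 (F_boundary \<rho>1 x))\<bar>"
      using assms(16) x(1) by (simp add: abs_mult)
    also have "\<dots> \<le> 1 / pi * (C * \<bar>x - x0\<bar> powr (1 / 3))"
      using assms(12) x by (intro mult_left_mono C) auto
    also have "\<dots> \<le> 1 / pi * (\<bar>C\<bar> * \<bar>x - x0\<bar> powr (1 / 3))"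
      by (intro mult_left_mono mult_right_mono) auto
    finally have "\<bar>p x\<bar> \<le> \<bar>C\<bar> / pi * \<bar>x - x0\<bar> powr (1 / 3)" by simp
    \<comment> \<open>At \<open>x = x0\<close> the denominator is 0 and the quotient has the default
      value 0.\<close>
    then show "norm a \<le> \<bar>C\<bar> / pi"
      unfolding x(3) by (cases "x = x0") (auto simp: abs_mult divide_simps split: if_splits)
  qed
qed

end
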